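(* Let $n$ be a positive integer and let $\Theta=(\theta_1,\dots,\theta_n)\in\mathbf{R}^n$ be a point such that $1,\theta_1,\dots,\theta_n$ are linearly independent over $\mathbf{Q}$. Then for every integer $d$ with $1\le d\le n-1$ we have $$ \frac{d\,\omega_d(\Theta)}{\omega_d(\Theta)+d+1}\;\le\;\omega_{d-1}(\Theta)\;\le\;\frac{(n-d)\,\omega_d(\Theta)-1}{n-d+1}. $$
   Context: Identify $\mathbf{R}^n$ with a subset of $\mathbf{P}^n(\mathbf{R})$ via $(x_1,\dots,x_n)\mapsto(1,x_1,\dots,x_n)$, so that $\Theta$ is also viewed as the point of $\mathbf{P}^n(\mathbf{R})$ with homogeneous coordinates $(1,\theta_1,\dots,\theta_n)$. Projective distance: equip $\mathbf{R}^{n+1}$ with the usual dot product and the Grassmann algebra $\Lambda(\mathbf{R}^{n+1})$ with the induced inner product (for any orthonormal basis $e_0,\dots,e_n$ of $\mathbf{R}^{n+1}$, the products $e_{i_1}\wedge\dots\wedge e_{i_k}$, $0\le i_1<\dots<i_k\le n$, $0\le k\le n+1$, form an orthonormal basis); $|\cdot|$ denotes the Euclidean norm. For points $P,Q\in\mathbf{P}^n(\mathbf{R})$ with homogeneous coordinates $\mathbf{x},\mathbf{y}$, put $\mathrm{d}(P,Q)=\frac{|\mathbf{x}\wedge\mathbf{y}|}{|\mathbf{x}|\,|\mathbf{y}|}$. For a real linear subvariety $L\subset\mathbf{P}^n(\mathbf{R})$ put $\mathrm{d}(\Theta,L)=\min_{P\in L}\mathrm{d}(\Theta,P)$, the minimum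 being over the real points of $L$. Height: a $d$-dimensional linear subvariety is $L=\mathbf{P}(V)$ with $V\subset\mathbf{R}^{n+1}$ a linear subspace of dimension $d+1$. Its Plücker coordinates are $\mathbf{X}=\mathbf{x}_0\wedge\dots\wedge\mathbf{x}_d\in\Lambda^{d+1}(\mathbf{R}^{n+1})\cong\mathbf{R}^{\binom{n+1}{d+1}}$ for any basis $\mathbf{x}_0,\dots,\mathbf{x}_d$ of $V$ (well defined up to a nonzero real scalar). $L$ is rational (over $\mathbf{Q}$) if $V$ is spanned by vectors of $\mathbf{Q}^{n+1}$. For rational $L$, the height $H(L)$ is the Weil height of a system of rational Plücker coordinates of $L$, normalized with the Euclidean norm at the Archimedean place; that is, $H(L)=|\mathbf{X}|$ when the Plücker coordinates $\mathbf{X}$ are chosen to be integers with greatest common divisor $1$. Exponents: for an integer $d$ with $0\le d\le n-1$, $\omega_d(\Theta)$ is the supremum (possibly $+\infty$) of the real numbers $\omega$ for which there exist infinitely many rational linear subvarieties $L\subset\mathbf{P}^n(\mathbf{R})$ with $\dim(L)=d$ and $\mathrm{d}(\Theta,L)\le H(L)^{-1-\omega}$. When $\omega_d(\Theta)=+\infty$, the bounds are read as limits: the left-hand side is $d$ and the right-hand side is $+\infty$. *)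

theory Defs
  imports "HOL-Analysis.Analysis"
begin

section \<open>Grassmann algebra with its induced Euclidean structure\<close>

text \<open>
  The Grassmann algebra of \<open>real ^ 'i\<close> is represented as \<open>real ^ ('i set)\<close>: the coordinate at
  \<open>I = {i\<^sub>1, \<dots>, i\<^sub>k}\<close>, listed increasingly, is the coefficient of
  \<open>e\<^bsub>i\<^sub>1\<^esub> \<and> \<dots> \<and> e\<^bsub>i\<^sub>k\<^esub>\<close>.  These products are
  orthonormal for the library's inner product on \<open>real ^ ('i set)\<close>, so the induced Euclidean norm
  is just \<open>norm\<close>.

  The index type is ordered by the injection \<open>to_nat\<close>, available for every finite type;
  another ordering only changes the signs of some basis elements.
  Hence \<open>e\<^sub>I \<and> e\<^sub>J\<close> is \<open>shuffle_sign I J\<close> times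
  \<open>e\<^bsub>I \<union> J\<^esub>\<close> if \<open>I\<close> and \<open>J\<close> are disjoint, and \<open>0\<close> otherwise.
\<close>

type_synonym 'i grassmann = "real ^ ('i set)"

definition shuffle_sign :: "'i::finite set \<Rightarrow> 'i set \<Rightarrow> real" where
  "shuffle_sign I J = (- 1) ^ card {(i, j). i \<in> I \<and> j \<in> J \<and> to_nat j < to_nat i}"

definition wedge :: "'i::finite grassmann \<Rightarrow> 'i grassmann \<Rightarrow> 'i grassmann"  (infixr "\<and>\<^sub>G" 70) where
  "a \<and>\<^sub>G b = (\<chi> K. \<Sum>I\<in>Pow K. shuffle_sign I (K - I) * a $ I * b $ (K - I))"

definition grassmann_one :: "'i::finite grassmann" where
  "grassmann_one = axis {} 1"

definition grassmann_vec :: "real ^ 'i::finite \<Rightarrow> 'i grassmann" where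
  "grassmann_vec x = (\<Sum>i\<in>UNIV. x $ i *\<^sub>R axis {i} 1)"

definition wedge_list :: "(real ^ 'i::finite) list \<Rightarrow> 'i grassmann" where
  "wedge_list xs = foldr (\<lambda>x a. grassmann_vec x \<and>\<^sub>G a) xs grassmann_one"


section \<open>Projective distance\<close>

text \<open>
  A point of projective space is given by any nonzero vector of homogeneous coordinates, and
  the linear subvariety \<open>P(V)\<close> by the subspace \<open>V\<close>; thus \<open>dim P(V) = dim V - 1\<close>.
\<close>

definition proj_dist :: "real ^ 'i::finite \<Rightarrow> real ^ 'i \<Rightarrow> real" where
  "proj_dist x y = norm (grassmann_vec x \<and>\<^sub>G grassmann_vec y) / (norm x * norm y)"

text \<open>The infimum is a minimum, see \<open>proj_dist_subspace_attained\<close> below.\<close>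

definition proj_dist_subspace :: "real ^ 'i::finite \<Rightarrow> (real ^ 'i) set \<Rightarrow> real" where
  "proj_dist_subspace x V = (INF y\<in>V - {0}. proj_dist x y)"

lemma grassmann_vec_scaleR: "grassmann_vec (c *\<^sub>R x) = c *\<^sub>R grassmann_vec x"
  by (simp add: grassmann_vec_def scaleR_sum_right)

lemma wedge_scaleR_right: "a \<and>\<^sub>G (c *\<^sub>R b) = c *\<^sub>R (a \<and>\<^sub>G b)"
  by (simp add: wedge_def vec_eq_iff sum_distrib_left mult_ac)

lemma proj_dist_scaleR_right:
  assumes "c \<noteq> 0"
  shows "proj_dist x (c *\<^sub>R y) = proj_dist x y"
  using assms by (simp add: proj_dist_def grassmann_vec_scaleR wedge_scaleR_right)

lemma proj_dist_subspace_attained: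
  fixes x :: "real ^ 'i::finite"
  assumes "subspace V" "V \<noteq> {0}"
  shows "\<exists>y\<in>V - {0}. proj_dist_subspace x V = proj_dist x y \<and>
           (\<forall>z\<in>V - {0}. proj_dist x y \<le> proj_dist x z)"
proof -
  let ?S = "V \<inter> sphere 0 1"
  have "0 \<in> V" using assms(1) by (rule subspace_0)
  then obtain v where v: "v \<in> V" "v \<noteq> 0" using assms(2) by blast
  have sgn_in: "sgn w \<in> ?S" if "w \<in> V" "w \<noteq> 0" for w
    using that assms(1) by (simp add: sgn_div_norm subspace_scale)
  have "compact ?S"
    using closed_subspace[OF assms(1)] by (simp add: closed_Int_compact)
  moreover have "?S \<noteq> {}" using sgn_in[OF v] by blast
  moreover have "continuous_on ?S (proj_dist x)"
  proof -
    have "continuous_on ?S (\<lambda>y. norm (grassmann_vec x \<and>\<^sub>G grassmann_vec y))"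
      unfolding wedge_def grassmann_vec_def
      by (intro continuous_intros continuous_on_vec_lambda)
    then have "continuous_on ?S (\<lambda>y. norm (grassmann_vec x \<and>\<^sub>G grassmann_vec y) / norm x)"
      unfolding divide_inverse by (rule continuous_on_mult_right)
    then show ?thesis
      by (rule continuous_on_eq) (simp add: proj_dist_def)
  qed
  ultimately obtain y where y: "y \<in> ?S" "\<And>z. z \<in> ?S \<Longrightarrow> proj_dist x y \<le> proj_dist x z"
    using continuous_attains_inf by metis
  have min: "proj_dist x y \<le> proj_dist x z" if "z \<in> V - {0}" for z
  proof -
    have "proj_dist x (sgn z) = proj_dist x z"
      unfolding sgn_div_norm using that by (intro proj_dist_scaleR_right) simp
    then show ?thesis using y(2)[OF sgn_in[of z]] that by simp
  qed
  have yV: "y \<in> V - {0}" using y(1) by auto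
  have "proj_dist_subspace x V = proj_dist x y"
    unfolding proj_dist_subspace_def using yV min by (intro cInf_eq_minimum) auto
  then show ?thesis using yV min by blast
qed


section \<open>Rational linear subvarieties and their height\<close>

definition rational_subspace :: "(real ^ 'i::finite) set \<Rightarrow> bool" where
  "rational_subspace V \<longleftrightarrow> (\<exists>S. (\<forall>x\<in>S. \<forall>i. x $ i \<in> \<rat>) \<and> V = span S)"

text \<open>The systems of Pluecker coordinates of \<open>P(V)\<close>; by varying the basis one gets all nonzero
  real multiples of a given one.\<close>

definition plucker_coords :: "(real ^ 'i::finite) set \<Rightarrow> 'i grassmann set" where
  "plucker_coords V =
     {wedge_list xs | xs. distinct xs \<and> independent (set xs) \<and> span (set xs) = V}"

text \<open>For rational \<open>V\<close> the primitive integral Pluecker coordinates are unique up to sign, so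
  their norm is uniquely determined.  For other \<open>V\<close> the value is unspecified.\<close>

definition height :: "(real ^ 'i::finite) set \<Rightarrow> real" where
  "height V = (THE h. \<exists>X\<in>plucker_coords V. \<exists>z :: 'i set \<Rightarrow> int.
      (\<forall>I. X $ I = of_int (z I)) \<and> Gcd (range z) = 1 \<and> h = norm X)"


section \<open>Exponents of approximation\<close>

definition homog :: "real ^ 'n::finite \<Rightarrow> real ^ ('n option)" where
  "homog \<Theta> = (\<chi> i. case i of None \<Rightarrow> 1 | Some j \<Rightarrow> \<Theta> $ j)"

definition approx_exponent :: "nat \<Rightarrow> real ^ 'n::finite \<Rightarrow> ereal" where
  "approx_exponent d \<Theta> = Sup {ereal w | w. infinite
      {V. rational_subspace V \<and> dim V = d + 1 \<and>
          proj_dist_subspace (homog \<Theta>) V \<le> height V powr (- 1 - w)}}"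

definition rat_independent :: "('i::finite \<Rightarrow> real) \<Rightarrow> bool" where
  "rat_independent f \<longleftrightarrow>
     (\<forall>q :: 'i \<Rightarrow> rat. (\<Sum>i\<in>UNIV. of_rat (q i) * f i) = 0 \<longrightarrow> (\<forall>i. q i = 0))"

end

theory Submission
  imports Defs
begin

text \<open>
  Let \<open>X\<close> be the primitive integral Pluecker vector of a rational subspace \<open>V\<close> and let \<open>u\<close> be
  homogeneous coordinates of \<open>\<Theta>\<close>. Then \<open>H(V) = |X|\<close> and \<open>d(\<Theta>, V) = |u \<and> X| / (|u| |X|)\<close>, and
  \<open>|X|\<close> is the covolume of the lattice of integer points of \<open>V\<close>. Both inequalities come from
  lattice reduction, so that Minkowski's theorem is replaced by Hermite's argument.

  Going up: the projection of the integer lattice to the orthogonal complement of \<open>V\<close> has rank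
  \<open>m = n + 1 - dim V\<close> and covolume \<open>1 / H(V)\<close>. Adding its shortest vector to \<open>V\<close> gives \<open>V' \<supseteq> V\<close> with
  \<open>H(V') \<lless> H(V)\<^bsup>1 - 1/m\<^esup>\<close>, and \<open>d(\<Theta>, V') \<le> d(\<Theta>, V)\<close>.

  Going down: let \<open>d(\<Theta>, V) \<le> \<epsilon> = H(V)\<^bsup>-1 - w\<^esup>\<close> and \<open>k = dim V\<close>. Multiplying lengths in the direction of
  \<open>u\<close> by \<open>\<epsilon>\<close> turns the lattice of \<open>V\<close> into one of covolume at most \<open>2 \<epsilon> H(V)\<close>. The first \<open>k - 1\<close>
  vectors of a reduced basis of the new lattice span \<open>V'\<close> for which \<open>\<epsilon> H(V')\<close> and
  \<open>d(\<Theta>, V') H(V')\<close> are both \<open>\<lless> (\<epsilon> H(V))\<^bsup>1 - 1/k\<^esup>\<close>.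
\<close>

section \<open>Exterior and interior multiplication by vectors\<close>

definition ext :: "real ^ 'i::finite \<Rightarrow> 'i grassmann \<Rightarrow> 'i grassmann" where
  "ext x a = grassmann_vec x \<and>\<^sub>G a"

text \<open>Interior multiplication by \<open>x\<close>, written in coordinates as the transpose of
  \<open>ext x\<close>; see \<open>inner_ext\<close>.\<close>

definition contr :: "real ^ 'i::finite \<Rightarrow> 'i grassmann \<Rightarrow> 'i grassmann" where
  "contr x a = (\<chi> K. \<Sum>i\<in>-K. shuffle_sign {i} K * x $ i * a $ insert i K)"

lemma shuffle_sign_singleton:
  "shuffle_sign {i} K = (- 1) ^ card {j\<in>K. to_nat j < to_nat i}"
proof -
  have "{(i', j). i' \<in> {i} \<and> j \<in> K \<and> to_nat j < to_nat i'} = Pair i ` {j\<in>K. to_nat j < to_nat i}"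
    by auto
  then show ?thesis by (simp add: shuffle_sign_def card_image inj_on_def)
qed

text \<open>Source of the minus signs in \<open>ext_anticommute\<close> and
  \<open>ext_contr\<close>: of two distinct indices exactly one precedes the other.\<close>

lemma shuffle_sign_singleton_insert:
  assumes "j \<notin> K"
  shows "shuffle_sign {i} (insert j K) = (if to_nat j < to_nat i then - 1 else 1) * shuffle_sign {i} K"
proof -
  have "{k\<in>insert j K. to_nat k < to_nat i} =
      (if to_nat j < to_nat i then insert j else id) {k\<in>K. to_nat k < to_nat i}" by auto
  then show ?thesis using assms by (simp add: shuffle_sign_singleton)
qed

lemma shuffle_sign_singleton_square [simp]: "shuffle_sign {i} K * shuffle_sign {i} K = 1"
  by (simp add: shuffle_sign_singleton flip: power_add)

lemma grassmann_vec_nth_singleton [simp]: "grassmann_vec x $ {i} = x $ i"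
  by (simp add: grassmann_vec_def axis_def if_distrib cong: if_cong)

lemma grassmann_vec_nth_eq_0: "(\<And>i. I \<noteq> {i}) \<Longrightarrow> grassmann_vec x $ I = 0"
  by (simp add: grassmann_vec_def axis_def)

text \<open>A vector has degree one, so only the singletons \<open>I\<close> contribute to the sum
  in \<open>wedge\<close>.\<close>

lemma ext_nth:
  "ext x a $ K = (\<Sum>i\<in>K. shuffle_sign {i} (K - {i}) * x $ i * a $ (K - {i}))"
proof -
  let ?f = "\<lambda>I. shuffle_sign I (K - I) * grassmann_vec x $ I * a $ (K - I)"
  have "ext x a $ K = sum ?f (Pow K)" by (simp add: ext_def wedge_def)
  also have "\<dots> = sum ?f ((\<lambda>i. {i}) ` K)"
    by (rule sum.mono_neutral_right) (auto intro!: grassmann_vec_nth_eq_0)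
  also have "\<dots> = (\<Sum>i\<in>K. ?f {i})" by (subst sum.reindex) auto
  finally show ?thesis by simp
qed

lemma contr_nth: "contr x a $ K = (\<Sum>i\<in>-K. shuffle_sign {i} K * x $ i * a $ insert i K)"
  by (simp add: contr_def)

lemma ext_add_left: "ext (x + y) a = ext x a + ext y a"
  by (simp add: vec_eq_iff ext_nth algebra_simps sum.distrib)

lemma ext_add_right: "ext x (a + b) = ext x a + ext x b"
  by (simp add: vec_eq_iff ext_nth algebra_simps sum.distrib)

lemma ext_scaleR_left: "ext (c *\<^sub>R x) a = c *\<^sub>R ext x a"
  by (simp add: vec_eq_iff ext_nth sum_distrib_left mult_ac)

lemma ext_scaleR_right: "ext x (c *\<^sub>R a) = c *\<^sub>R ext x a"
  by (simp add: vec_eq_iff ext_nth sum_distrib_left mult_ac)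

lemma contr_add_right: "contr x (a + b) = contr x a + contr x b"
  by (simp add: vec_eq_iff contr_nth algebra_simps sum.distrib)

lemma contr_scaleR_right: "contr x (c *\<^sub>R a) = c *\<^sub>R contr x a"
  by (simp add: vec_eq_iff contr_nth sum_distrib_left mult_ac)

lemma linear_ext: "linear (ext x)"
  by (rule linearI) (simp_all add: ext_add_right ext_scaleR_right)

lemma linear_ext_left: "linear (\<lambda>x. ext x a)"
  by (rule linearI) (simp_all add: ext_add_left ext_scaleR_left)

lemma linear_contr: "linear (contr x)"
  by (rule linearI) (simp_all add: contr_add_right contr_scaleR_right)

lemmas ext_zero_right [simp] = linear_0[OF linear_ext]
lemmas ext_zero_left [simp] = linear_0[OF linear_ext_left]
lemmas contr_zero_right [simp] = linear_0[OF linear_contr]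

lemma ext_anticommute: "ext x (ext y a) = - ext y (ext x a)"
proof -
  have *: "ext x (ext y a) $ K = - ext y (ext x a) $ K" for K
  proof -
    let ?t = "\<lambda>i j. shuffle_sign {i} (K - {i}) * x $ i *
          (shuffle_sign {j} (K - {i} - {j}) * y $ j * a $ (K - {i} - {j}))"
    let ?t' = "\<lambda>j i. shuffle_sign {j} (K - {j}) * y $ j *
          (shuffle_sign {i} (K - {j} - {i}) * x $ i * a $ (K - {j} - {i}))"
    \<comment> \<open>Relative to \<open>K - {i} - {j}\<close>, exactly one of the two orders of
      removal picks up a minus sign.\<close>
    have anti: "?t i j = - ?t' j i" if "i \<in> K" "j \<in> K" "i \<noteq> j" for i j
    proof -
      have D: "K - {j} - {i} = K - {i} - {j}" by blast
      have i: "K - {i} = insert j (K - {i} - {j})" and j: "K - {j} = insert i (K - {i} - {j})"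
        using that by auto
      have ne: "to_nat i \<noteq> to_nat j" using that by simp
      have 1: "shuffle_sign {i} (K - {i}) = (if to_nat j < to_nat i then - 1 else 1) * shuffle_sign {i} (K - {i} - {j})"
        by (subst i, subst shuffle_sign_singleton_insert) auto
      have 2: "shuffle_sign {j} (K - {j}) = (if to_nat i < to_nat j then - 1 else 1) * shuffle_sign {j} (K - {i} - {j})"
        by (subst j, subst shuffle_sign_singleton_insert) auto
      show ?thesis unfolding D 1 2 using ne by auto
    qed
    have "ext x (ext y a) $ K = (\<Sum>i\<in>K. \<Sum>j\<in>K - {i}. ?t i j)"
      by (simp add: ext_nth sum_distrib_left)
    also have "\<dots> = (\<Sum>i\<in>K. \<Sum>j\<in>K. if i = j then 0 else ?t i j)"
      by (intro sum.cong sum.mono_neutral_cong_left) auto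
    also have "\<dots> = (\<Sum>j\<in>K. \<Sum>i\<in>K. if i = j then 0 else ?t i j)" by (rule sum.swap)
    also have "\<dots> = (\<Sum>j\<in>K. \<Sum>i\<in>K - {j}. - ?t' j i)"
    proof (rule sum.cong[OF refl])
      fix j assume "j \<in> K"
      then have "(\<Sum>i\<in>K. if i = j then 0 else ?t i j) = (\<Sum>i\<in>K. if i = j then 0 else - ?t' j i)"
        by (intro sum.cong refl) (metis anti)
      also have "\<dots> = (\<Sum>i\<in>K - {j}. - ?t' j i)"
        by (intro sum.mono_neutral_cong_right) auto
      finally show "(\<Sum>i\<in>K. if i = j then 0 else ?t i j) = (\<Sum>i\<in>K - {j}. - ?t' j i)" .
    qed
    also have "\<dots> = - ext y (ext x a) $ K"
      by (simp add: ext_nth sum_distrib_left sum_negf)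
    finally show ?thesis .
  qed
  show ?thesis by (simp add: vec_eq_iff *)
qed

lemma ext_ext_same [simp]: "ext x (ext x a) = 0"
  using ext_anticommute[of x x a] by (simp add: eq_neg_iff_add_eq_0 flip: scaleR_2)

text \<open>The Clifford relation. The diagonal terms of the first composition supply the summands
  of \<open>x \<bullet> y\<close> with index in \<open>K\<close>, those of the second the remaining
  ones; off the diagonal the terms cancel in pairs.\<close>

lemma ext_contr: "ext x (contr y a) + contr y (ext x a) = (x \<bullet> y) *\<^sub>R a"
proof -
  have *: "ext x (contr y a) $ K + contr y (ext x a) $ K = (x \<bullet> y) * a $ K" for K
  proof -
    let ?t = "\<lambda>i j. shuffle_sign {i} (K - {i}) * x $ i *
          (shuffle_sign {j} (K - {i}) * y $ j * a $ insert j (K - {i}))"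
    let ?t' = "\<lambda>j i. shuffle_sign {j} K * y $ j *
          (shuffle_sign {i} (insert j K - {i}) * x $ i * a $ (insert j K - {i}))"
    have anti: "?t' j i = - ?t i j" if "i \<in> K" "j \<notin> K" for i j
    proof -
      have D: "insert j K - {i} = insert j (K - {i})" using that by auto
      have i: "K = insert i (K - {i})" using that by auto
      have ne: "to_nat i \<noteq> to_nat j" using that by auto
      have 1: "shuffle_sign {j} K = (if to_nat i < to_nat j then - 1 else 1) * shuffle_sign {j} (K - {i})"
        by (subst i, subst shuffle_sign_singleton_insert) auto
      have 2: "shuffle_sign {i} (insert j (K - {i})) = (if to_nat j < to_nat i then - 1 else 1) * shuffle_sign {i} (K - {i})"
        using that by (subst shuffle_sign_singleton_insert) auto
      show ?thesis unfolding D 1 2 using ne by auto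
    qed
    have tii: "?t i i = x $ i * y $ i * a $ K" if "i \<in> K" for i
      using that shuffle_sign_singleton_square[of i "K - {i}"] by (simp add: insert_absorb mult_ac)
    have tii': "?t' j j = x $ j * y $ j * a $ K" if "j \<notin> K" for j
      using that shuffle_sign_singleton_square[of j "K"] by (simp add: mult_ac)
    have "ext x (contr y a) $ K = (\<Sum>i\<in>K. \<Sum>j\<in>insert i (-K). ?t i j)"
      by (simp add: ext_nth contr_nth sum_distrib_left Compl_Diff_eq distrib_left)
    also have "\<dots> = (\<Sum>i\<in>K. x $ i * y $ i * a $ K + (\<Sum>j\<in>-K. ?t i j))"
      by (rule sum.cong[OF refl], subst sum.insert) (simp_all only: tii, simp_all)
    finally have 1: "ext x (contr y a) $ K = (\<Sum>i\<in>K. x $ i * y $ i * a $ K) + (\<Sum>i\<in>K. \<Sum>j\<in>-K. ?t i j)"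
      by (simp add: sum.distrib)
    have "contr y (ext x a) $ K = (\<Sum>j\<in>-K. \<Sum>i\<in>insert j K. ?t' j i)"
      by (simp add: ext_nth contr_nth sum_distrib_left distrib_left)
    also have "\<dots> = (\<Sum>j\<in>-K. x $ j * y $ j * a $ K + (\<Sum>i\<in>K. ?t' j i))"
      by (rule sum.cong[OF refl], subst sum.insert) (simp_all only: Compl_iff tii', simp_all)
    also have "\<dots> = (\<Sum>j\<in>-K. x $ j * y $ j * a $ K) + (\<Sum>j\<in>-K. \<Sum>i\<in>K. - ?t i j)"
      unfolding sum.distrib using anti by (intro arg_cong2[where f = "(+)"] refl sum.cong) auto
    also have "(\<Sum>j\<in>-K. \<Sum>i\<in>K. - ?t i j) = - (\<Sum>i\<in>K. \<Sum>j\<in>-K. ?t i j)"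
      by (subst sum.swap) (simp add: sum_negf)
    finally have 2: "contr y (ext x a) $ K = (\<Sum>j\<in>-K. x $ j * y $ j * a $ K) - (\<Sum>i\<in>K. \<Sum>j\<in>-K. ?t i j)"
      by simp
    have "(\<Sum>i\<in>K. x $ i * y $ i * a $ K) + (\<Sum>j\<in>-K. x $ j * y $ j * a $ K) = (\<Sum>i\<in>UNIV. x $ i * y $ i * a $ K)"
      using sum.union_disjoint[of K "-K" "\<lambda>i. x $ i * y $ i * a $ K"] by (simp add: Compl_partition)
    then show ?thesis
      unfolding 1 2 by (simp add: inner_vec_def sum_distrib_right)
  qed
  show ?thesis by (simp add: vec_eq_iff *)
qed

text \<open>Reindexing the pairs \<open>(K, i)\<close> with \<open>i \<in> K\<close> by
  \<open>(K - {i}, i)\<close> matches the two sums term by term.\<close>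

lemma inner_ext: "ext x a \<bullet> b = a \<bullet> contr x b"
proof -
  have "ext x a \<bullet> b = (\<Sum>(K, i)\<in>Sigma UNIV (\<lambda>K. K). shuffle_sign {i} (K - {i}) * x $ i * a $ (K - {i}) * b $ K)"
    by (simp add: inner_vec_def ext_nth sum_distrib_right sum.Sigma)
  also have "\<dots> = (\<Sum>(K, i)\<in>Sigma UNIV (\<lambda>K. - K). a $ K * (shuffle_sign {i} K * x $ i * b $ insert i K))"
    by (rule sum.reindex_bij_witness[where i = "\<lambda>(K, i). (insert i K, i)" and j = "\<lambda>(K, i). (K - {i}, i)"])
      (auto simp: insert_absorb)
  also have "\<dots> = a \<bullet> contr x b"
    by (simp add: inner_vec_def contr_nth sum_distrib_left sum.Sigma)
  finally show ?thesis .
qed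

text \<open>Move \<open>ext x\<close> across by adjointness, then apply the Clifford
  relation.\<close>

lemma inner_ext_ext: "ext x a \<bullet> ext y b = (x \<bullet> y) * (a \<bullet> b) - contr y a \<bullet> contr x b"
proof -
  have "contr x (ext y b) = (x \<bullet> y) *\<^sub>R b - ext y (contr x b)"
    using ext_contr[of y x b] unfolding eq_diff_eq by (simp add: inner_commute add.commute)
  then show ?thesis
    by (simp add: inner_ext[of x] inner_diff_right inner_ext[of y] inner_commute[of a "ext y (contr x b)"] inner_commute[of "contr x b"])
qed

lemma norm_ext_square: "(norm (ext x a))\<^sup>2 = (norm x)\<^sup>2 * (norm a)\<^sup>2 - (norm (contr x a))\<^sup>2"
  using inner_ext_ext[of x a x a] by (simp add: power2_norm_eq_inner)

lemma norm_ext_le: "norm (ext x a) \<le> norm x * norm a"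
  by (rule power2_le_imp_le) (simp_all add: norm_ext_square power_mult_distrib)

section \<open>Wedge products of lists\<close>

lemma wedge_list_Nil [simp]: "wedge_list [] = grassmann_one"
  by (simp add: wedge_list_def)

lemma wedge_list_Cons [simp]: "wedge_list (x # xs) = ext x (wedge_list xs)"
  by (simp add: wedge_list_def ext_def)

lemma norm_grassmann_one [simp]: "norm grassmann_one = 1"
  by (simp add: grassmann_one_def)

lemma contr_grassmann_one [simp]: "contr x grassmann_one = 0"
  by (simp add: vec_eq_iff contr_nth grassmann_one_def axis_def)

text \<open>A factor anticommutes towards its own copy, where the product vanishes; linearity in
  \<open>x\<close> does the rest.\<close>

lemma ext_wedge_list_span:
  assumes "x \<in> span (set xs)"
  shows "ext x (wedge_list xs) = 0"
proof -
  have "ext y (wedge_list xs) = 0" if "y \<in> set xs" for y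
    using that by (induction xs) (auto simp: ext_anticommute[of y])
  then have "span (set xs) \<subseteq> {y. ext y (wedge_list xs) = 0}"
    by (intro span_minimal linear_subspace_kernel linear_ext_left) auto
  then show ?thesis using assms by auto
qed

lemma contr_wedge_list_orthogonal:
  assumes "\<And>y. y \<in> set xs \<Longrightarrow> x \<bullet> y = 0"
  shows "contr x (wedge_list xs) = 0"
  using assms
proof (induction xs)
  case (Cons y xs)
  then have "contr x (wedge_list xs) = 0" "x \<bullet> y = 0" by simp_all
  then show ?case using ext_contr[of y x "wedge_list xs"] by (simp add: inner_commute[of y])
qed simp

text \<open>Splits \<open>x\<close> along the span and its orthogonal complement: the part
  \<open>s\<close> contributes nothing to the product, and on the part \<open>p\<close> the norm is
  multiplicative by \<open>norm_ext_wedge_list_orthogonal\<close>.\<close>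

lemma ext_wedge_list_decomp:
  obtains s p where "x = s + p" "s \<in> span (set xs)" "\<And>y. y \<in> span (set xs) \<Longrightarrow> p \<bullet> y = 0"
    "ext x (wedge_list xs) = ext p (wedge_list xs)" "contr p (wedge_list xs) = 0"
proof -
  obtain s p where sp: "s \<in> span (set xs)" "\<And>y. y \<in> span (set xs) \<Longrightarrow> orthogonal p y" "x = s + p"
    using orthogonal_subspace_decomp_exists[of "set xs" x] by blast
  have "contr p (wedge_list xs) = 0"
    using sp(2) by (intro contr_wedge_list_orthogonal) (auto simp: orthogonal_def span_base)
  with sp show ?thesis
    by (intro that[of s p]) (auto simp: orthogonal_def ext_add_left ext_wedge_list_span)
qed

lemma norm_ext_wedge_list_orthogonal:
  assumes "contr p (wedge_list xs) = 0"
  shows "norm (ext p (wedge_list xs)) = norm p * norm (wedge_list xs)"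
  using norm_ext_square[of p "wedge_list xs"] assms
  by (simp add: power_mult_distrib[symmetric])

lemma ext_wedge_list_eq_0_iff:
  "ext x (wedge_list xs) = 0 \<longleftrightarrow> x \<in> span (set xs) \<or> wedge_list xs = 0"
proof
  assume *: "ext x (wedge_list xs) = 0"
  obtain s p where sp: "x = s + p" "s \<in> span (set xs)" 
    "ext x (wedge_list xs) = ext p (wedge_list xs)" "contr p (wedge_list xs) = 0"
    by (rule ext_wedge_list_decomp)
  then have "norm p * norm (wedge_list xs) = 0"
    using * norm_ext_wedge_list_orthogonal by (metis norm_zero)
  with sp show "x \<in> span (set xs) \<or> wedge_list xs = 0" by auto
qed (auto simp: ext_wedge_list_span)

lemma wedge_list_nonzero_iff: "wedge_list xs \<noteq> 0 \<longleftrightarrow> distinct xs \<and> independent (set xs)"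
proof (induction xs)
  case Nil
  have "grassmann_one \<noteq> 0" using norm_grassmann_one norm_zero by (metis zero_neq_one)
  then show ?case by (simp add: independent_empty)
next
  case (Cons x xs)
  then show ?case
    by (auto simp: ext_wedge_list_eq_0_iff independent_insert span_base split: if_splits)
qed

text \<open>With \<open>p\<close> and \<open>q\<close> the components of \<open>x\<close> and
  \<open>y\<close> orthogonal to the span, both sides are the Gram determinant of \<open>p\<close>
  and \<open>q\<close> times the fourth power of \<open>norm W\<close>.\<close>

lemma gram_ext_wedge_list:
  fixes xs :: "(real ^ 'i::finite) list"
  defines "W \<equiv> wedge_list xs"
  shows "(norm (ext y (ext x W)))\<^sup>2 * (norm W)\<^sup>2 =
    (norm (ext x W))\<^sup>2 * (norm (ext y W))\<^sup>2 - (ext x W \<bullet> ext y W)\<^sup>2"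
proof -
  obtain p where p: "ext x W = ext p W" "contr p W = 0"
    unfolding W_def by (rule ext_wedge_list_decomp)
  obtain q where q: "ext y W = ext q W" "contr q W = 0"
    unfolding W_def by (rule ext_wedge_list_decomp)
  have "ext y (ext p W) = ext q (ext p W)"
    using q(1) by (metis ext_anticommute)
  moreover have "contr q (ext p W) = (p \<bullet> q) *\<^sub>R W"
    using ext_contr[of p q W] q(2) by simp
  ultimately have "(norm (ext y (ext x W)))\<^sup>2 = (norm q)\<^sup>2 * (norm (ext p W))\<^sup>2 - (p \<bullet> q)\<^sup>2 * (norm W)\<^sup>2"
    using p(1) norm_ext_square[of q "ext p W"] by (simp add: power_mult_distrib)
  moreover have "(norm (ext p W))\<^sup>2 = (norm p)\<^sup>2 * (norm W)\<^sup>2" "(norm (ext q W))\<^sup>2 = (norm q)\<^sup>2 * (norm W)\<^sup>2"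
    using norm_ext_square[of p W] norm_ext_square[of q W] p q by simp_all
  moreover have "ext p W \<bullet> ext q W = (p \<bullet> q) * (norm W)\<^sup>2"
    using inner_ext_ext[of p W q W] q by (simp add: power2_norm_eq_inner)
  ultimately show ?thesis
    unfolding p(1) q(1) by (simp add: power_mult_distrib left_diff_distrib flip: power_mult)
qed

section \<open>Products of combinations over a subring of the reals\<close>

primrec coeff_span :: "real set \<Rightarrow> 'v::real_vector list \<Rightarrow> 'v set" where
  "coeff_span R [] = {0}"
| "coeff_span R (x # xs) = {c *\<^sub>R x + y | c y. c \<in> R \<and> y \<in> coeff_span R xs}"

lemma coeff_span_UNIV: "coeff_span UNIV xs = span (set xs)"
proof (induction xs)
  case (Cons x xs)
  show ?case
    unfolding coeff_span.simps Cons.IH set_simps set_eq_iff span_breakdown_eq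
    by (simp, metis add.commute diff_add_cancel add_diff_cancel_left')
qed simp

text \<open>The degree \<open>m\<close> part of the \<open>R\<close>-subalgebra generated by \<open>xs\<close>.\<close>

primrec graded_span :: "real set \<Rightarrow> (real ^ 'i::finite) list \<Rightarrow> nat \<Rightarrow> 'i grassmann set" where
  "graded_span R [] m = (if m = 0 then {c *\<^sub>R grassmann_one | c. c \<in> R} else {0})"
| "graded_span R (x # xs) m =
    {a + ext x b | a b. a \<in> graded_span R xs m \<and>
       b \<in> (case m of 0 \<Rightarrow> {0} | Suc k \<Rightarrow> graded_span R xs k)}"

text \<open>Serves two subrings at once: over the reals the top degree yields proportionality of
  Pluecker vectors, over the integers an integral change of basis factor.\<close>

locale coeff_ring =
  fixes R :: "real set"
  assumes one: "1 \<in> R"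
    and diff: "a \<in> R \<Longrightarrow> b \<in> R \<Longrightarrow> a - b \<in> R"
    and mult: "a \<in> R \<Longrightarrow> b \<in> R \<Longrightarrow> a * b \<in> R"
begin

lemma zero: "0 \<in> R" using diff[OF one one] by simp
lemma minus: "a \<in> R \<Longrightarrow> - a \<in> R" using diff[OF zero, of a] by simp
lemma add: "a \<in> R \<Longrightarrow> b \<in> R \<Longrightarrow> a + b \<in> R" using diff[of a "- b"] minus by simp

lemma graded_span_scaleR: "a \<in> graded_span R xs m \<Longrightarrow> c \<in> R \<Longrightarrow> c *\<^sub>R a \<in> graded_span R xs m"
proof (induction xs arbitrary: a m)
  case Nil
  then show ?case by (auto intro: mult split: if_splits)
next
  case (Cons x xs)
  let ?Q = "case m of 0 \<Rightarrow> {0} | Suc k \<Rightarrow> graded_span R xs k"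
  obtain p q where pq: "a = p + ext x q" "p \<in> graded_span R xs m" "q \<in> ?Q"
    using Cons.prems(1) by auto
  have "c *\<^sub>R q \<in> ?Q" using pq(3) Cons.IH Cons.prems(2) by (auto split: nat.splits)
  moreover have "c *\<^sub>R a = c *\<^sub>R p + ext x (c *\<^sub>R q)"
    by (simp add: pq(1) scaleR_add_right ext_scaleR_right)
  ultimately show ?case
    using Cons.IH[OF pq(2) Cons.prems(2)] unfolding graded_span.simps by blast
qed

lemma graded_span_add: "a \<in> graded_span R xs m \<Longrightarrow> b \<in> graded_span R xs m \<Longrightarrow> a + b \<in> graded_span R xs m"
proof (induction xs arbitrary: a b m)
  case Nil
  then show ?case by (auto simp: scaleR_add_left[symmetric] intro: add split: if_splits)
next
  case (Cons x xs)
  let ?Q = "case m of 0 \<Rightarrow> {0} | Suc k \<Rightarrow> graded_span R xs k"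
  obtain p q where pq: "a = p + ext x q" "p \<in> graded_span R xs m" "q \<in> ?Q" using Cons.prems(1) by auto
  obtain p' q' where pq': "b = p' + ext x q'" "p' \<in> graded_span R xs m" "q' \<in> ?Q" using Cons.prems(2) by auto
  have "q + q' \<in> ?Q" using pq(3) pq'(3) Cons.IH by (auto split: nat.splits)
  moreover have "a + b = (p + p') + ext x (q + q')" by (simp add: pq(1) pq'(1) ext_add_right)
  ultimately show ?case using Cons.IH pq pq' unfolding graded_span.simps by blast
qed

lemma graded_span_zero: "0 \<in> graded_span R xs m"
proof (induction xs arbitrary: m)
  case Nil
  then show ?case using zero by (auto intro!: exI[of _ "0::real"])
next
  case (Cons x xs)
  then show ?case by (auto split: nat.splits intro!: exI[of _ 0])
qed

lemma graded_span_vanish: "length xs < m \<Longrightarrow> graded_span R xs m = {0}"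
  by (induction xs arbitrary: m) (auto split: nat.splits)

text \<open>By \<open>graded_span_vanish\<close> the summand without the leading generator is zero
  in top degree, so every generator must occur.\<close>

lemma graded_span_top: "a \<in> graded_span R xs (length xs) \<Longrightarrow> \<exists>c\<in>R. a = c *\<^sub>R wedge_list xs"
proof (induction xs arbitrary: a)
  case (Cons x xs)
  then obtain b where "b \<in> graded_span R xs (length xs)" "a = ext x b"
    by (auto simp: graded_span_vanish)
  with Cons.IH show ?case by (force simp: ext_scaleR_right)
qed auto

lemma ext_graded_span_base:
  "y \<in> set xs \<Longrightarrow> a \<in> graded_span R xs m \<Longrightarrow> ext y a \<in> graded_span R xs (Suc m)"
proof (induction xs arbitrary: a m)
  case (Cons x xs)
  let ?Q = "case m of 0 \<Rightarrow> {0} | Suc k \<Rightarrow> graded_span R xs k"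
  obtain p q where pq: "a = p + ext x q" "p \<in> graded_span R xs m" "q \<in> ?Q" using Cons.prems(2) by auto
  show ?case
  proof (cases "y = x")
    case True
    then have "ext y a = 0 + ext x p" by (simp add: pq(1) ext_add_right)
    moreover have "0 \<in> graded_span R xs (Suc m)" by (rule graded_span_zero)
    ultimately show ?thesis using pq(2) unfolding graded_span.simps nat.case by blast
  next
    case False
    then have y: "y \<in> set xs" using Cons.prems(1) by simp
    have "(- 1) *\<^sub>R ext y q \<in> graded_span R xs m"
      using pq(3) Cons.IH[OF y] graded_span_zero by (intro graded_span_scaleR minus one) (auto split: nat.splits)
    moreover have "ext y a = ext y p + ext x ((- 1) *\<^sub>R ext y q)"
      by (simp add: pq(1) ext_add_right ext_anticommute[of y x] linear_neg[OF linear_ext])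
    ultimately show ?thesis
      using Cons.IH[OF y pq(2)] unfolding graded_span.simps nat.case by blast
  qed
qed simp

lemma ext_graded_span:
  assumes "y \<in> coeff_span R xs" "a \<in> graded_span R xs m"
  shows "ext y a \<in> graded_span R xs (Suc m)"
proof -
  \<comment> \<open>Inducting over a separate list \<open>zs\<close> of generators keeps the ambient
    \<open>xs\<close> fixed.\<close>
  have "set zs \<subseteq> set xs \<Longrightarrow> y \<in> coeff_span R zs \<Longrightarrow> ext y a \<in> graded_span R xs (Suc m)" for zs
  proof (induction zs arbitrary: y)
    case Nil
    then show ?case using graded_span_zero by simp
  next
    case (Cons z zs)
    then obtain c y' where y: "y = c *\<^sub>R z + y'" "c \<in> R" "y' \<in> coeff_span R zs" by auto
    show ?case
      unfolding y(1) ext_add_left ext_scaleR_left using Cons y(2,3) assms(2)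
      by (intro graded_span_add graded_span_scaleR ext_graded_span_base Cons.IH) auto
  qed
  then show ?thesis using assms by blast
qed

text \<open>A product of \<open>length xs\<close> combinations has top degree, where only multiples
  of \<open>wedge_list xs\<close> exist; \<open>c\<close> plays the role of the determinant of the
  coefficients.\<close>

lemma wedge_list_coeff_span:
  assumes "set ys \<subseteq> coeff_span R xs" "length ys = length xs"
  shows "\<exists>c\<in>R. wedge_list ys = c *\<^sub>R wedge_list xs"
proof -
  have one_mem: "grassmann_one \<in> graded_span R xs 0"
  proof (induction xs)
    case Nil
    show ?case using one by (auto intro!: exI[of _ "1::real"])
  qed auto
  have "set zs \<subseteq> coeff_span R xs \<Longrightarrow> wedge_list zs \<in> graded_span R xs (length zs)" for zs
    by (induction zs) (auto simp: one_mem intro: ext_graded_span)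
  then show ?thesis using graded_span_top assms by metis
qed

end

interpretation Real_coeff: coeff_ring UNIV by standard auto
interpretation Int_coeff: coeff_ring \<int> by standard auto

lemma wedge_list_proportional:
  assumes "set ys \<subseteq> span (set xs)" "length ys = length xs"
  obtains c where "wedge_list ys = c *\<^sub>R wedge_list xs"
  using Real_coeff.wedge_list_coeff_span[of ys xs] assms by (auto simp: coeff_span_UNIV)

section \<open>Squeezing one direction\<close>

text \<open>For a unit vector \<open>u\<close> this is induced by the linear map that multiplies \<open>u\<close> by \<open>e\<close> and
  fixes its orthogonal complement.\<close>

definition squeeze :: "real ^ 'i::finite \<Rightarrow> real \<Rightarrow> 'i grassmann \<Rightarrow> 'i grassmann" where
  "squeeze u e a = a + (e - 1) *\<^sub>R ext u (contr u a)"

lemma linear_squeeze: "linear (squeeze u e)"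
  unfolding squeeze_def
  by (intro linear_compose_add linear_compose_scale_right linear_compose[unfolded o_def, OF linear_contr linear_ext] linear_ident)

lemma squeeze_one [simp]: "squeeze u 1 a = a"
  by (simp add: squeeze_def)

text \<open>Rewrites \<open>contr u (ext x a)\<close> by the Clifford relation. Iterated over a
  list, this turns a squeezed product into the product of the squeezed vectors.\<close>

lemma squeeze_ext:
  "squeeze u e (ext x a) = ext (x + ((e - 1) * (x \<bullet> u)) *\<^sub>R u) (squeeze u e a)"
proof -
  have contr: "contr u (ext x a) = (x \<bullet> u) *\<^sub>R a - ext x (contr u a)"
    using ext_contr[of x u a] unfolding eq_diff_eq by (simp add: add.commute)
  show ?thesis
    by (simp add: contr squeeze_def linear_diff[OF linear_ext] ext_add_left ext_add_right ext_scaleR_left ext_scaleR_right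
        ext_anticommute[of x u] scaleR_diff_right)
qed

lemma squeeze_wedge_list:
  "squeeze u e (wedge_list xs) = wedge_list (map (\<lambda>x. x + ((e - 1) * (x \<bullet> u)) *\<^sub>R u) xs)"
  by (induction xs) (simp_all add: squeeze_ext, simp add: squeeze_def)

text \<open>For a unit vector \<open>u\<close> the Clifford relation splits \<open>a\<close> into
  orthogonal parts \<open>P\<close> and \<open>Q\<close>; only \<open>Q\<close>, the part divisible
  by \<open>u\<close>, is scaled by \<open>e\<close>, while \<open>P\<close> has the norm of
  \<open>ext u a\<close>.\<close>

lemma norm_squeeze_square:
  assumes "norm u = 1"
  shows "(norm (squeeze u e a))\<^sup>2 = (norm (ext u a))\<^sup>2 + e\<^sup>2 * ((norm a)\<^sup>2 - (norm (ext u a))\<^sup>2)"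
proof -
  define P Q where "P = contr u (ext u a)" and "Q = ext u (contr u a)"
  have uu: "u \<bullet> u = 1" using assms by (simp add: norm_eq_1)
  have a: "a = P + Q" using ext_contr[of u u a] uu by (simp add: P_def Q_def add.commute)
  have PQ: "P \<bullet> Q = 0"
    using inner_ext[of u Q "ext u a"] by (simp add: P_def Q_def inner_commute)
  have "P \<bullet> P = ext u a \<bullet> ext u P"
    using inner_ext[of u P "ext u a"] by (simp add: P_def inner_commute)
  moreover have "ext u P = ext u a"
    using arg_cong[OF a, of "ext u"] by (simp add: ext_add_right Q_def)
  ultimately have P: "(norm P)\<^sup>2 = (norm (ext u a))\<^sup>2" by (simp add: power2_norm_eq_inner)
  have pyth: "(norm (P + c *\<^sub>R Q))\<^sup>2 = (norm P)\<^sup>2 + c\<^sup>2 * (norm Q)\<^sup>2" for c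
    using PQ by (simp add: power2_norm_eq_inner inner_add inner_commute[of Q P] power2_eq_square[of c])
  have "(norm a)\<^sup>2 = (norm P)\<^sup>2 + (norm Q)\<^sup>2" using pyth[of 1] a by simp
  moreover have "squeeze u e a = P + e *\<^sub>R Q"
    unfolding squeeze_def Q_def[symmetric] by (simp add: a algebra_simps)
  ultimately show ?thesis using pyth[of e] P by simp
qed

text \<open>One squeezed norm controls two quantities: \<open>e * norm a\<close> will carry the
  height, and \<open>norm (ext u a)\<close> the distance times the height.\<close>

lemma norm_squeeze_bounds:
  assumes "norm u = 1" "0 < e" "e \<le> 1"
  shows "e * norm a \<le> norm (squeeze u e a)" "norm (ext u a) \<le> norm (squeeze u e a)"
    "norm (squeeze u e a) \<le> norm (ext u a) + e * norm a"
proof -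
  have le: "(norm (ext u a))\<^sup>2 \<le> (norm a)\<^sup>2" using norm_ext_le[of u a] assms(1) by (simp add: power_mono)
  have e: "e\<^sup>2 \<le> 1" using assms by (simp add: power_le_one)
  have "(e * norm a)\<^sup>2 \<le> (norm (squeeze u e a))\<^sup>2"
    using mult_nonneg_nonneg[of "1 - e\<^sup>2" "(norm (ext u a))\<^sup>2"] e
    by (simp add: norm_squeeze_square[OF assms(1)] power_mult_distrib algebra_simps)
  then show "e * norm a \<le> norm (squeeze u e a)" using power2_le_imp_le norm_ge_zero by blast
  have "(norm (ext u a))\<^sup>2 \<le> (norm (squeeze u e a))\<^sup>2"
    using le by (simp add: norm_squeeze_square[OF assms(1)])
  then show "norm (ext u a) \<le> norm (squeeze u e a)" using power2_le_imp_le norm_ge_zero by blast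
  have "(norm (squeeze u e a))\<^sup>2 \<le> (norm (ext u a) + e * norm a)\<^sup>2"
    using assms by (simp add: norm_squeeze_square[OF assms(1)] power2_sum power_mult_distrib algebra_simps)
  then show "norm (squeeze u e a) \<le> norm (ext u a) + e * norm a"
    by (rule power2_le_imp_le) (use assms in simp)
qed

section \<open>Integer vectors and heights\<close>

definition int_vec :: "real ^ 'a::finite \<Rightarrow> bool" where
  "int_vec x \<longleftrightarrow> (\<forall>i. x $ i \<in> \<int>)"

lemma int_vec_diff: "int_vec x \<Longrightarrow> int_vec y \<Longrightarrow> int_vec (x - y)"
  by (simp add: int_vec_def)

lemma int_vec_scaleR: "c \<in> \<int> \<Longrightarrow> int_vec x \<Longrightarrow> int_vec (c *\<^sub>R x)"
  by (simp add: int_vec_def)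

lemma int_vec_axis: "int_vec (axis i 1)"
  by (simp add: int_vec_def axis_def)

lemma int_vec_ext: "int_vec x \<Longrightarrow> int_vec a \<Longrightarrow> int_vec (ext x a)"
  by (auto simp: int_vec_def ext_nth shuffle_sign_def intro!: Ints_sum Ints_mult Ints_power)

lemma int_vec_wedge_list: "\<forall>x\<in>set xs. int_vec x \<Longrightarrow> int_vec (wedge_list xs)"
  by (induction xs) (simp_all add: int_vec_ext, simp add: grassmann_one_def int_vec_axis)

lemma int_vec_norm_ge_1:
  assumes "int_vec x" "x \<noteq> 0"
  shows "1 \<le> norm x"
proof -
  obtain i where "x $ i \<noteq> 0" using assms(2) by (auto simp: vec_eq_iff)
  then have "1 \<le> \<bar>x $ i\<bar>" using assms(1) by (simp add: int_vec_def Ints_nonzero_abs_ge1)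
  then show ?thesis using component_le_norm_cart[of x i] by linarith
qed

lemma finite_int_vec_bounded: "finite {x :: real ^ 'a::finite. int_vec x \<and> norm x \<le> M}"
proof -
  have "vec_nth ` {x :: real ^ 'a. int_vec x \<and> norm x \<le> M} \<subseteq> (UNIV \<rightarrow>\<^sub>E {k \<in> \<int>. \<bar>k\<bar> \<le> M})"
    using component_le_norm_cart order_trans by (fastforce simp: int_vec_def)
  moreover have "finite (UNIV \<rightarrow>\<^sub>E {k :: real. k \<in> \<int> \<and> \<bar>k\<bar> \<le> M} :: ('a \<Rightarrow> real) set)"
    by (intro finite_PiE finite_abs_int_segment) auto
  ultimately show ?thesis
    by (metis (no_types, lifting) finite_imageD finite_subset inj_on_def vec_nth_inject)
qed

section \<open>Primitive vectors\<close>

definition primitive :: "real ^ 'a::finite \<Rightarrow> bool" where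
  "primitive x \<longleftrightarrow> (\<exists>z :: 'a \<Rightarrow> int. (\<forall>i. x $ i = of_int (z i)) \<and> Gcd (range z) = 1)"

lemma primitive_int_vec: "primitive x \<Longrightarrow> int_vec x"
  by (auto simp: primitive_def int_vec_def)

lemma primitive_nonzero: "primitive x \<Longrightarrow> x \<noteq> 0"
proof
  assume "primitive x" "x = 0"
  then obtain z where z: "Gcd (range z) = (1::int)" "\<forall>i. z i = 0" by (auto simp: primitive_def)
  then have "range z = {0}" by auto
  with z(1) show False by simp
qed

text \<open>The factor \<open>c\<close> is rational, and its denominator in lowest terms divides
  every coordinate of \<open>x\<close>, hence their gcd, which is 1.\<close>

lemma primitive_scaleR_Ints:
  assumes "primitive x" "int_vec (c *\<^sub>R x)"
  shows "c \<in> \<int>"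
proof -
  obtain z where z: "\<And>i. x $ i = of_int (z i)" "Gcd (range z) = 1" using assms(1) by (auto simp: primitive_def)
  have "\<exists>w. c * x $ i = of_int w" for i using assms(2) by (auto simp: int_vec_def elim: Ints_cases)
  then obtain w where w: "\<And>i. c * x $ i = of_int (w i)" by metis
  obtain i where i: "z i \<noteq> 0" using primitive_nonzero[OF assms(1)] z(1) by (auto simp: vec_eq_iff)
  then have "c = of_int (w i) / of_int (z i)" using w[of i] z(1)[of i] by (simp add: field_simps)
  then have "c \<in> \<rat>" by simp
  then obtain a b where ab: "b > 0" "coprime a b" "c = of_int a / of_int b" by (rule Rats_cases')
  have "b dvd z j" for j
  proof -
    have "of_int (a * z j) = (of_int (b * w j) :: real)"
      using w[of j] z(1)[of j] ab(1,3) by (simp add: field_simps)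
    then have "b dvd a * z j" by (simp only: of_int_eq_iff dvd_triv_left)
    then show ?thesis using ab(2) by (simp add: coprime_commute coprime_dvd_mult_right_iff)
  qed
  then have "b dvd Gcd (range z)" by (intro Gcd_greatest) auto
  then have "b = 1" using z(2) ab(1) by simp
  then show ?thesis using ab(3) by simp
qed

lemma primitive_divide_Gcd:
  assumes "int_vec y" "y \<noteq> 0"
  obtains g :: int where "0 < g" "primitive ((1 / of_int g) *\<^sub>R y)"
proof -
  have "\<exists>w. y $ i = of_int w" for i using assms(1) by (auto simp: int_vec_def elim: Ints_cases)
  then obtain z where z: "\<And>i. y $ i = of_int (z i)" by metis
  define g where "g = Gcd (range z)"
  have "range z \<noteq> {0}" "range z \<noteq> {}" using assms(2) z by (auto simp: vec_eq_iff)
  then have "g \<noteq> 0" unfolding g_def using Gcd_0_iff subset_singletonD by metis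
  then have g: "g > 0" unfolding g_def using Gcd_int_greater_eq_0[of "range z"] by linarith
  have dvd: "g * (z i div g) = z i" for i by (simp add: g_def)
  \<comment> \<open>Pulling the factor \<open>g\<close> out of \<open>Gcd (range z) = g\<close>
    leaves gcd 1 for the quotients.\<close>
  have "(\<lambda>x. g * x) ` range (\<lambda>i. z i div g) = range z" by (simp add: image_image dvd)
  then have "g = normalize (g * Gcd (range (\<lambda>i. z i div g)))" by (metis Gcd_mult g_def)
  then have "Gcd (range (\<lambda>i. z i div g)) = 1" using g by (simp add: abs_mult)
  moreover have "((1 / of_int g) *\<^sub>R y) $ i = of_int (z i div g)" for i
    using arg_cong[OF dvd[of i], of real_of_int] g by (simp add: z field_simps)
  ultimately have "primitive ((1 / of_int g) *\<^sub>R y)"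
    unfolding primitive_def by (intro exI[of _ "\<lambda>i. z i div g"]) simp
  with g show ?thesis by (rule that)
qed

section \<open>Pluecker coordinates and the height\<close>

lemma plucker_coords_iff:
  "X \<in> plucker_coords V \<longleftrightarrow> (\<exists>xs. X = wedge_list xs \<and> X \<noteq> 0 \<and> span (set xs) = V)"
  unfolding plucker_coords_def using wedge_list_nonzero_iff by blast

lemma wedge_list_length: "wedge_list xs \<noteq> 0 \<Longrightarrow> length xs = dim (span (set xs))"
  using wedge_list_nonzero_iff[of xs] by (simp add: dim_eq_card_independent distinct_card)

lemma plucker_coords_proportional:
  assumes "X \<in> plucker_coords V" "Y \<in> plucker_coords V"
  obtains c where "c \<noteq> 0" "Y = c *\<^sub>R X"
proof -
  obtain xs where xs: "X = wedge_list xs" "X \<noteq> 0" "span (set xs) = V"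
    using assms(1) by (auto simp: plucker_coords_iff)
  obtain ys where ys: "Y = wedge_list ys" "Y \<noteq> 0" "span (set ys) = V"
    using assms(2) by (auto simp: plucker_coords_iff)
  have "length ys = length xs" using wedge_list_length xs ys by metis
  moreover have "set ys \<subseteq> span (set xs)" using xs(3) ys(3) span_superset by metis
  ultimately obtain c where "wedge_list ys = c *\<^sub>R wedge_list xs"
    using wedge_list_proportional by blast
  then show ?thesis using that xs ys by force
qed

text \<open>Scale one vector of a basis; \<open>V \<noteq> {0}\<close> guarantees that there is
  one.\<close>

lemma plucker_coords_scaleR:
  assumes "X \<in> plucker_coords V" "c \<noteq> 0" "V \<noteq> {0}"
  shows "c *\<^sub>R X \<in> plucker_coords V"
proof -
  obtain xs where xs: "X = wedge_list xs" "X \<noteq> 0" "span (set xs) = V"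
    using assms(1) by (auto simp: plucker_coords_iff)
  then obtain y ys where y: "xs = y # ys" using assms(3) by (cases xs) auto
  have "span (set ((c *\<^sub>R y) # ys)) = V"
  proof
    have "y = (1 / c) *\<^sub>R (c *\<^sub>R y)" using assms(2) by simp
    then have "y \<in> span (insert (c *\<^sub>R y) (set ys))" by (metis insertI1 span_base span_scale)
    then show "V \<subseteq> span (set ((c *\<^sub>R y) # ys))"
      unfolding xs(3)[symmetric] y by (intro span_minimal) (auto intro: span_base)
    show "span (set ((c *\<^sub>R y) # ys)) \<subseteq> V"
      unfolding xs(3)[symmetric] y by (intro span_minimal) (auto intro: span_base span_scale)
  qed
  moreover have "c *\<^sub>R X = wedge_list ((c *\<^sub>R y) # ys)" by (simp add: xs(1) y ext_scaleR_left)
  moreover have "c *\<^sub>R X \<noteq> 0" using xs(2) assms(2) by simp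
  ultimately show ?thesis unfolding plucker_coords_iff by blast
qed

text \<open>Two primitive Pluecker vectors of \<open>V\<close> differ by an integer factor whose
  inverse is also an integer, hence by a sign. So the description in \<open>height\<close> is
  unique.\<close>

lemma height_eq:
  assumes "X \<in> plucker_coords V" "primitive X"
  shows "height V = norm X"
proof -
  have "norm Y = norm X" if Y: "Y \<in> plucker_coords V" "primitive Y" for Y
  proof -
    obtain c where c: "c \<noteq> 0" "Y = c *\<^sub>R X" using plucker_coords_proportional[OF assms(1) Y(1)] .
    then have "c \<in> \<int>" using primitive_scaleR_Ints assms(2) primitive_int_vec[OF Y(2)] by blast
    then have 1: "1 \<le> \<bar>c\<bar>" using c(1) by (simp add: Ints_nonzero_abs_ge1)
    have "(1 / c) *\<^sub>R Y = X" using c by simp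
    then have "1 / c \<in> \<int>" using primitive_scaleR_Ints Y(2) primitive_int_vec[OF assms(2)] by metis
    then have "1 \<le> \<bar>1 / c\<bar>" using c(1) by (intro Ints_nonzero_abs_ge1) auto
    with 1 c(1) have "\<bar>c\<bar> = 1" by (simp add: field_simps)
    then show ?thesis using c(2) by simp
  qed
  then have "(THE h. \<exists>Y\<in>plucker_coords V. primitive Y \<and> h = norm Y) = norm X"
    using assms by (intro the_equality) blast+
  moreover have "(\<exists>z. (\<forall>I. Y $ I = of_int (z I)) \<and> Gcd (range z) = 1 \<and> h = norm Y) \<longleftrightarrow>
      primitive Y \<and> h = norm Y" for Y :: "'a grassmann" and h
    by (auto simp: primitive_def)
  ultimately show ?thesis by (simp only: height_def)
qed

lemma primitive_plucker_exists:
  assumes "Y \<in> plucker_coords V" "int_vec Y" "V \<noteq> {0}"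
  obtains X where "X \<in> plucker_coords V" "primitive X" "height V = norm X"
proof -
  have "Y \<noteq> 0" using assms(1) by (auto simp: plucker_coords_iff)
  then obtain g :: int where "0 < g" "primitive ((1 / of_int g) *\<^sub>R Y)"
    using primitive_divide_Gcd assms(2) by blast
  moreover from this have "(1 / of_int g) *\<^sub>R Y \<in> plucker_coords V"
    using plucker_coords_scaleR[OF assms(1) _ assms(3)] by simp
  ultimately show ?thesis using that height_eq by blast
qed

text \<open>An integral Pluecker vector is a nonzero integer multiple of a primitive one.\<close>

lemma height_le:
  assumes "Y \<in> plucker_coords V" "int_vec Y" "V \<noteq> {0}"
  shows "height V \<le> norm Y"
proof -
  obtain X where X: "X \<in> plucker_coords V" "primitive X" "height V = norm X"
    using primitive_plucker_exists[OF assms] .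
  obtain c where c: "c \<noteq> 0" "Y = c *\<^sub>R X" using plucker_coords_proportional[OF X(1) assms(1)] .
  then have "c \<in> \<int>" using primitive_scaleR_Ints X(2) assms(2) by blast
  then have "1 \<le> \<bar>c\<bar>" using c(1) by (simp add: Ints_nonzero_abs_ge1)
  then show ?thesis using c(2) X(3) by (simp add: mult_le_cancel_right1)
qed

section \<open>Integer points of rational subspaces and lattice bases\<close>

lemma rational_subspace_iff_int_span:
  "rational_subspace V \<longleftrightarrow> span {x \<in> V. int_vec x} = V"
proof
  assume "rational_subspace V"
  then obtain S where S: "\<And>x i. x \<in> S \<Longrightarrow> x $ i \<in> \<rat>" "V = span S" by (auto simp: rational_subspace_def)
  have "x \<in> span {x \<in> V. int_vec x}" if x: "x \<in> S" for x
  proof -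
    have "\<exists>b::int. b > 0 \<and> of_int b * x $ i \<in> \<int>" for i
      using Rats_cases'[OF S(1)[OF x, of i]] by (metis Ints_of_int nonzero_mult_div_cancel_left of_int_0_eq_iff order_less_irrefl times_divide_eq_right)
    then obtain b :: "'a \<Rightarrow> int" where b: "\<And>i. b i > 0" "\<And>i. of_int (b i) * x $ i \<in> \<int>" by metis
    \<comment> \<open>The product of the denominators of all coordinates clears each of
      them.\<close>
    define c :: real where "c = of_int (prod b UNIV)"
    have c: "c \<noteq> 0" using b(1) by (simp add: c_def) (metis less_irrefl)
    have "c * x $ i \<in> \<int>" for i
    proof -
      have "c * x $ i = of_int (prod b (UNIV - {i})) * (of_int (b i) * x $ i)"
        unfolding c_def by (subst prod.remove[of UNIV i]) (auto simp: mult_ac)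
      then show ?thesis using Ints_mult[OF Ints_of_int b(2)[of i]] by metis
    qed
    then have "c *\<^sub>R x \<in> {x \<in> V. int_vec x}" using x S(2) by (auto simp: int_vec_def span_base span_scale)
    then have "(1 / c) *\<^sub>R (c *\<^sub>R x) \<in> span {x \<in> V. int_vec x}" by (intro span_scale span_base)
    then show ?thesis using c by simp
  qed
  then have "V \<subseteq> span {x \<in> V. int_vec x}" unfolding S(2) by (intro span_minimal) auto
  moreover have "span {x \<in> V. int_vec x} \<subseteq> V" by (intro span_minimal) (auto simp: S(2))
  ultimately show "span {x \<in> V. int_vec x} = V" by blast
next
  assume *: "span {x \<in> V. int_vec x} = V"
  show "rational_subspace V"
    unfolding rational_subspace_def
    by (rule exI[of _ "{x \<in> V. int_vec x}"]) (use * Ints_subset_Rats in \<open>auto simp: int_vec_def\<close>)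
qed

lemma rational_subspace_int_span: "\<forall>x\<in>S. int_vec x \<Longrightarrow> rational_subspace (span S)"
  unfolding rational_subspace_def int_vec_def using Ints_subset_Rats by blast

text \<open>A basis over \<open>\<int>\<close> of the lattice of integer points in the span; the
  nonzero product encodes distinctness and linear independence.\<close>

definition int_basis :: "(real ^ 'i::finite) list \<Rightarrow> bool" where
  "int_basis xs \<longleftrightarrow> (\<forall>x\<in>set xs. int_vec x) \<and> wedge_list xs \<noteq> 0 \<and>
     (\<forall>x. int_vec x \<and> x \<in> span (set xs) \<longrightarrow> x \<in> coeff_span \<int> xs)"

lemma int_basis_Nil: "int_basis []"
  using wedge_list_nonzero_iff[of "[]"] by (simp add: int_basis_def independent_empty)

lemma int_basis_plucker: "int_basis xs \<Longrightarrow> wedge_list xs \<in> plucker_coords (span (set xs))"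
  by (auto simp: int_basis_def plucker_coords_iff)

text \<open>For \<open>L\<close> the identity, the minimised norm is the length of the component of
  \<open>p\<close> orthogonal to the span, up to the fixed factor
  \<open>norm (wedge_list xs)\<close>; thus \<open>p\<close> represents a shortest vector of the
  projected lattice. A squeeze \<open>L\<close> gives the same for the deformed lattice.\<close>

definition extends_minimally ::
  "('i::finite grassmann \<Rightarrow> 'i grassmann) \<Rightarrow> (real ^ 'i) set \<Rightarrow> real ^ 'i \<Rightarrow> (real ^ 'i) list \<Rightarrow> bool" where
  "extends_minimally L V p xs \<longleftrightarrow> int_vec p \<and> p \<in> V \<and> p \<notin> span (set xs) \<and>
     (\<forall>q. int_vec q \<and> q \<in> V \<and> q \<notin> span (set xs) \<longrightarrow>
        norm (L (ext p (wedge_list xs))) \<le> norm (L (ext q (wedge_list xs))))"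

lemma extends_minimally_exists:
  assumes low: "0 < c" "\<And>a. c * norm a \<le> norm (L a)"
    and xs: "\<forall>x\<in>set xs. int_vec x"
    and V: "rational_subspace V" "\<not> V \<subseteq> span (set xs)"
  shows "\<exists>p. extends_minimally L V p xs"
proof -
  define S where "S = {q. int_vec q \<and> q \<in> V \<and> q \<notin> span (set xs)}"
  let ?f = "\<lambda>q. ext q (wedge_list xs)"
  have "S \<noteq> {}"
  proof
    assume "S = {}"
    then have "{x \<in> V. int_vec x} \<subseteq> span (set xs)" by (auto simp: S_def)
    then have "span {x \<in> V. int_vec x} \<subseteq> span (set xs)" by (intro span_minimal) auto
    then show False using V by (simp add: rational_subspace_iff_int_span)
  qed
  then obtain q0 where q0: "q0 \<in> S" by blast
  \<comment> \<open>Minimise over products, not vectors: vectors differing by an element of the span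
    have the same product, and only finitely many integral products are bounded by that of
    \<open>q0\<close>.\<close>
  let ?F = "{Y \<in> ?f ` S. norm (L Y) \<le> norm (L (?f q0))}"
  have "?F \<subseteq> {Y. int_vec Y \<and> norm Y \<le> norm (L (?f q0)) / c}"
  proof
    fix Y assume Y: "Y \<in> ?F"
    then have "int_vec Y" using int_vec_wedge_list[OF xs] by (auto simp: S_def int_vec_ext)
    moreover have "c * norm Y \<le> norm (L (?f q0))" using low(2)[of Y] Y by auto
    ultimately show "Y \<in> {Y. int_vec Y \<and> norm Y \<le> norm (L (?f q0)) / c}"
      using low(1) by (simp add: field_simps)
  qed
  then have "finite ?F" using finite_int_vec_bounded finite_subset by blast
  moreover have "?F \<noteq> {}" using q0 by auto
  ultimately obtain Y where Y: "Y \<in> ?F" "\<And>Z. Z \<in> ?F \<Longrightarrow> norm (L Y) \<le> norm (L Z)"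
    using ex_min_if_finite[of "(\<lambda>Y. norm (L Y)) ` ?F"] by (auto simp: not_less image_iff)
  then obtain p where p: "p \<in> S" "Y = ?f p" by auto
  have "norm (L (?f p)) \<le> norm (L (?f q))" if "q \<in> S" for q
  proof (cases "norm (L (?f q)) \<le> norm (L (?f q0))")
    case True
    then show ?thesis using Y(2)[of "?f q"] that p(2) by auto
  next
    case False
    then show ?thesis using Y(1) p(2) by auto
  qed
  with p(1) show ?thesis unfolding extends_minimally_def S_def by blast
qed

text \<open>Subtracting the integer part of the \<open>p\<close>-coordinate leaves an integer vector
  whose product is a proper fraction of that of \<open>p\<close>; minimality puts it into the span
  of \<open>xs\<close>, where \<open>xs\<close> is already a lattice basis.\<close>

lemma int_basis_Cons:
  assumes L: "linear L" "0 < c" "\<And>a. c * norm a \<le> norm (L a)"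
    and xs: "int_basis xs" and V: "subspace V" "set xs \<subseteq> V"
    and p: "extends_minimally L V p xs"
  shows "int_basis (p # xs)"
proof -
  let ?W = "wedge_list xs"
  have W: "?W \<noteq> 0" "\<forall>x\<in>set xs. int_vec x" using xs by (auto simp: int_basis_def)
  have pW: "ext p ?W \<noteq> 0" using p W by (auto simp: extends_minimally_def ext_wedge_list_eq_0_iff)
  then have "0 < c * norm (ext p ?W)" using L(2) by simp
  then have LpW: "0 < norm (L (ext p ?W))" using L(3)[of "ext p ?W"] by (rule less_le_trans)
  have "x \<in> coeff_span \<int> (p # xs)" if x: "int_vec x" "x \<in> span (set (p # xs))" for x
  proof -
    obtain t where t: "x - t *\<^sub>R p \<in> span (set xs)" using x(2) by (auto simp: span_breakdown_eq)
    define q where "q = x - of_int \<lfloor>t\<rfloor> *\<^sub>R p"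
    have q_eq: "q = (x - t *\<^sub>R p) + frac t *\<^sub>R p" by (simp add: q_def frac_def algebra_simps)
    have "ext q ?W = frac t *\<^sub>R ext p ?W"
      unfolding q_eq by (simp add: ext_add_left ext_wedge_list_span[OF t] ext_scaleR_left)
    then have "norm (L (ext q ?W)) = frac t * norm (L (ext p ?W))"
      by (simp add: linear_scale[OF L(1)])
    also have "\<dots> < norm (L (ext p ?W))" using LpW frac_lt_1[of t] by simp
    finally have less: "norm (L (ext q ?W)) < norm (L (ext p ?W))" .
    have int: "int_vec q" unfolding q_def using x(1) p by (auto intro!: int_vec_diff int_vec_scaleR simp: extends_minimally_def)
    have "span (set (p # xs)) \<subseteq> V" using p V by (intro span_minimal) (auto simp: extends_minimally_def)
    then have "q \<in> V" unfolding q_def using x(2) p V(1) by (auto simp: extends_minimally_def subspace_diff subspace_scale)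
    then have "q \<in> span (set xs)" using p less int by (auto simp: extends_minimally_def)
    then have "q \<in> coeff_span \<int> xs" using xs int by (auto simp: int_basis_def)
    moreover have "x = of_int \<lfloor>t\<rfloor> *\<^sub>R p + q" by (simp add: q_def)
    ultimately show ?thesis unfolding coeff_span.simps using Ints_of_int by blast
  qed
  moreover have "\<forall>x\<in>set (p # xs). int_vec x" using W p by (auto simp: extends_minimally_def)
  ultimately show ?thesis using pW by (simp add: int_basis_def)
qed

text \<open>Keeps every intermediate basis, because the later estimates compare the products of
  consecutive members.\<close>

lemma int_basis_chain:
  assumes L: "linear L" "0 < c" "\<And>a. c * norm a \<le> norm (L a)"
    and xs: "int_basis xs" "set xs \<subseteq> V" and V: "rational_subspace V" "dim V = length xs + m"
  shows "\<exists>G. G 0 = xs \<and> (\<forall>i\<le>m. int_basis (G i) \<and> set (G i) \<subseteq> V \<and> length (G i) = length xs + i) \<and>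
    (\<forall>i<m. \<exists>p. extends_minimally L V p (G i) \<and> G (Suc i) = p # G i)"
  using xs V(2)
proof (induction m arbitrary: xs)
  case 0
  then show ?case by (intro exI[of _ "\<lambda>_. xs"]) auto
next
  case (Suc m)
  have sV: "subspace V" using V(1) by (auto simp: rational_subspace_def)
  have "length xs = dim (span (set xs))" using Suc.prems(1) by (simp add: int_basis_def wedge_list_length)
  then have "\<not> V \<subseteq> span (set xs)" using dim_subset[of V "span (set xs)"] Suc.prems(3) by auto
  moreover have "\<forall>x\<in>set xs. int_vec x" using Suc.prems(1) by (simp add: int_basis_def)
  ultimately obtain p where p: "extends_minimally L V p xs"
    using extends_minimally_exists[OF L(2,3) _ V(1)] by blast
  have "int_basis (p # xs)" using int_basis_Cons[OF L Suc.prems(1) sV Suc.prems(2) p] .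
  moreover have "set (p # xs) \<subseteq> V" using p Suc.prems(2) by (auto simp: extends_minimally_def)
  ultimately obtain G where G: "G 0 = p # xs"
    "\<forall>i\<le>m. int_basis (G i) \<and> set (G i) \<subseteq> V \<and> length (G i) = length (p # xs) + i"
    "\<forall>i<m. \<exists>p. extends_minimally L V p (G i) \<and> G (Suc i) = p # G i"
    using Suc.IH[of "p # xs"] Suc.prems(3) by auto
  let ?G = "\<lambda>i. case i of 0 \<Rightarrow> xs | Suc j \<Rightarrow> G j"
  show ?case
  proof (intro exI[of _ ?G] conjI allI impI)
    fix i assume "i \<le> Suc m"
    then show "int_basis (?G i)" "set (?G i) \<subseteq> V" "length (?G i) = length xs + i"
      using G(2) Suc.prems by (auto split: nat.splits)
  next
    fix i assume "i < Suc m"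
    then show "\<exists>q. extends_minimally L V q (?G i) \<and> ?G (Suc i) = q # ?G i"
      using G(1,3) p by (auto split: nat.splits)
  qed simp
qed

section \<open>Reduced bases\<close>

lemma grassmann_vec_eq_ext: "grassmann_vec x = ext x grassmann_one"
proof -
  have "grassmann_vec x $ K = ext x grassmann_one $ K" for K
  proof (cases "\<exists>i. K = {i}")
    case True
    then obtain i where K: "K = {i}" by blast
    have "shuffle_sign {i} {} = 1" by (simp add: shuffle_sign_singleton)
    then show ?thesis by (simp add: K ext_nth grassmann_one_def)
  next
    case False
    then have "K - {i} \<noteq> {}" if "i \<in> K" for i using that by auto
    then have "ext x grassmann_one $ K = 0" by (simp add: ext_nth grassmann_one_def axis_def)
    then show ?thesis using False by (simp add: grassmann_vec_nth_eq_0)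
  qed
  then show ?thesis by (simp add: vec_eq_iff)
qed

text \<open>Lagrange's identity, from the Clifford relation applied to
  \<open>grassmann_one\<close>.\<close>

lemma norm_ext_grassmann_vec_square:
  "(norm (ext x (grassmann_vec y)))\<^sup>2 = (norm x)\<^sup>2 * (norm y)\<^sup>2 - (x \<bullet> y)\<^sup>2"
proof -
  have "contr x (grassmann_vec y) = (y \<bullet> x) *\<^sub>R grassmann_one"
    using ext_contr[of y x grassmann_one] by (simp add: grassmann_vec_eq_ext)
  then have "(norm (contr x (grassmann_vec y)))\<^sup>2 = (x \<bullet> y)\<^sup>2" by (simp add: inner_commute power2_eq_square)
  moreover have "(norm (grassmann_vec y))\<^sup>2 = (norm y)\<^sup>2"
    using norm_ext_square[of y grassmann_one] by (simp add: grassmann_vec_eq_ext)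
  ultimately show ?thesis using norm_ext_square[of x "grassmann_vec y"] by simp
qed

text \<open>Write \<open>u = s + p\<close> with \<open>s\<close> in \<open>V\<close> and
  \<open>p\<close> orthogonal to it. Both sides equal \<open>norm p / norm u\<close>: Cauchy-Schwarz
  shows that no point of \<open>V\<close> is closer, and \<open>s\<close> attains the value unless
  it is zero.\<close>

lemma proj_dist_subspace_eq:
  fixes u :: "real ^ 'i::finite"
  assumes X: "X \<in> plucker_coords V" and V: "V \<noteq> {0}" and u: "u \<noteq> 0"
  shows "proj_dist_subspace u V = norm (ext u X) / (norm u * norm X)"
proof -
  obtain xs where xs: "X = wedge_list xs" "X \<noteq> 0" "span (set xs) = V"
    using X by (auto simp: plucker_coords_iff)
  obtain s p where sp: "u = s + p" "s \<in> span (set xs)" "\<And>y. y \<in> span (set xs) \<Longrightarrow> p \<bullet> y = 0"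
    "ext u (wedge_list xs) = ext p (wedge_list xs)" "contr p (wedge_list xs) = 0"
    using ext_wedge_list_decomp[of u xs] by metis
  have pyth: "(norm u)\<^sup>2 = (norm s)\<^sup>2 + (norm p)\<^sup>2"
    using sp(3)[OF sp(2)] by (simp add: sp(1) power2_norm_eq_inner inner_add inner_commute)
  have norm_ext: "norm (ext u X) = norm p * norm X"
    using sp(4) norm_ext_wedge_list_orthogonal[OF sp(5)] xs(1) by simp
  have dist: "proj_dist u y = norm (ext u (grassmann_vec y)) / (norm u * norm y)" for y
    by (simp add: proj_dist_def ext_def)
  have inner: "u \<bullet> y = s \<bullet> y" if "y \<in> V" for y
    using sp(1,3) that xs(3) by (simp add: inner_add_left)
  have lower: "norm p / norm u \<le> proj_dist u y" if y: "y \<in> V - {0}" for y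
  proof -
    have "(s \<bullet> y)\<^sup>2 \<le> (norm s)\<^sup>2 * (norm y)\<^sup>2"
      using Cauchy_Schwarz_ineq[of s y] by (simp add: power2_norm_eq_inner)
    then have "(norm p * norm y)\<^sup>2 \<le> (norm (ext u (grassmann_vec y)))\<^sup>2"
      using y by (simp add: norm_ext_grassmann_vec_square inner pyth power_mult_distrib algebra_simps)
    then have "norm p * norm y \<le> norm (ext u (grassmann_vec y))"
      using power2_le_imp_le norm_ge_zero by blast
    then show ?thesis using y u by (simp add: dist field_simps)
  qed
  obtain y where y: "y \<in> V - {0}" "proj_dist u y = norm p / norm u"
  proof (cases "s = 0")
    \<comment> \<open>Here \<open>u\<close> is orthogonal to \<open>V\<close>, and every nonzero
      vector of \<open>V\<close> has distance 1.\<close>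
    case True
    obtain y where y: "y \<in> V - {0}" using V xs(3) span_0 by fastforce
    then have "(norm (ext u (grassmann_vec y)))\<^sup>2 = (norm u * norm y)\<^sup>2"
      using True by (simp add: norm_ext_grassmann_vec_square inner power_mult_distrib)
    then have "norm (ext u (grassmann_vec y)) = norm u * norm y"
      by (rule power2_eq_imp_eq) simp_all
    then have "proj_dist u y = 1" using y u by (simp add: dist)
    moreover have "p = u" using True sp(1) by simp
    ultimately have "proj_dist u y = norm p / norm u" using u by simp
    with y show ?thesis by (rule that)
  next
    case False
    then have s: "s \<in> V - {0}" using sp(2) xs(3) by simp
    then have "u \<bullet> s = (norm s)\<^sup>2" by (simp add: inner power2_norm_eq_inner)
    then have "(norm (ext u (grassmann_vec s)))\<^sup>2 = (norm p * norm s)\<^sup>2"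
      unfolding norm_ext_grassmann_vec_square pyth by algebra
    then have "norm (ext u (grassmann_vec s)) = norm p * norm s"
      by (rule power2_eq_imp_eq) simp_all
    then have "proj_dist u s = norm p / norm u" using False by (simp add: dist)
    with s show ?thesis by (rule that)
  qed
  have "proj_dist_subspace u V = norm p / norm u"
    unfolding proj_dist_subspace_def using y lower by (intro cInf_eq_minimum) (auto intro!: image_eqI)
  then show ?thesis using norm_ext xs(2) by simp
qed

section \<open>The height as the norm of a lattice basis product\<close>

lemma rational_subspace_UNIV: "rational_subspace UNIV"
proof -
  have "(Basis :: (real ^ 'a) set) \<subseteq> {x. int_vec x}" by (auto simp: Basis_vec_def int_vec_axis)
  then have "UNIV \<subseteq> span {x :: real ^ 'a. int_vec x}" using span_mono span_Basis by metis
  then show ?thesis by (auto simp: rational_subspace_iff_int_span)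
qed

lemma norm_wedge_list_Basis:
  "distinct zs \<Longrightarrow> set zs \<subseteq> Basis \<Longrightarrow> norm (wedge_list zs) = 1"
proof (induction zs)
  case (Cons z zs)
  then have "contr z (wedge_list zs) = 0"
    by (intro contr_wedge_list_orthogonal inner_not_same_Basis) auto
  then show ?case using Cons norm_ext_wedge_list_orthogonal[of z zs] by (simp add: norm_Basis)
qed simp

text \<open>The standard basis has integer coordinates with respect to \<open>xs\<close>, so 1 is a
  nonzero integer multiple of the norm, which is itself at least 1 by integrality.\<close>

lemma norm_wedge_int_basis_UNIV:
  assumes "int_basis xs" "span (set xs) = (UNIV :: (real ^ 'i::finite) set)"
  shows "norm (wedge_list xs) = 1"
proof -
  obtain es :: "(real ^ 'i) list" where es: "set es = Basis" "distinct es"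
    using finite_distinct_list[OF finite_Basis] by blast
  have W: "wedge_list xs \<noteq> 0" "int_vec (wedge_list xs)" 
    using assms(1) by (auto simp: int_basis_def int_vec_wedge_list)
  have "length xs = DIM(real ^ 'i)" using wedge_list_length[OF W(1)] assms(2) dim_UNIV by metis
  moreover have "length es = DIM(real ^ 'i)" using es distinct_card by metis
  moreover have "set es \<subseteq> coeff_span \<int> xs"
    using assms unfolding es(1) by (auto simp: int_basis_def Basis_vec_def int_vec_axis)
  ultimately obtain c where c: "c \<in> \<int>" "wedge_list es = c *\<^sub>R wedge_list xs"
    using Int_coeff.wedge_list_coeff_span[of es xs] by auto
  then have *: "\<bar>c\<bar> * norm (wedge_list xs) = 1" using norm_wedge_list_Basis[of es] es by simp
  then have "c \<noteq> 0" by auto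
  then have "1 \<le> \<bar>c\<bar>" using c(1) by (simp add: Ints_nonzero_abs_ge1)
  then have "norm (wedge_list xs) \<le> 1" using * mult_right_mono[of 1 "\<bar>c\<bar>" "norm (wedge_list xs)"] by simp
  then show ?thesis using int_vec_norm_ge_1[OF W(2,1)] by simp
qed

lemma int_basis_exists:
  assumes "rational_subspace V"
  obtains xs where "int_basis xs" "span (set xs) = V"
proof -
  obtain G where G: "\<forall>i\<le>dim V. int_basis (G i) \<and> set (G i) \<subseteq> V \<and> length (G i) = i"
    using int_basis_chain[of "\<lambda>a. a" 1 "[]" V "dim V"] assms by (auto simp: int_basis_Nil linear_ident)
  let ?xs = "G (dim V)"
  have xs: "int_basis ?xs" "set ?xs \<subseteq> V" "length ?xs = dim V" using G by auto
  then have "dim (span (set ?xs)) = dim V" by (metis int_basis_def wedge_list_length)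
  moreover have V: "subspace V" using assms by (auto simp: rational_subspace_def)
  ultimately have "span (set ?xs) = V"
    using xs(2) by (intro subspace_dim_equal span_minimal) auto
  with xs(1) show ?thesis by (rule that)
qed

text \<open>Extend \<open>xs\<close> to a basis of the full integer lattice, whose product has norm
  1. The factor \<open>c\<close> between \<open>wedge_list xs\<close> and the primitive vector
  \<open>X\<close> persists in that product, which forces
  \<open>\<bar>c\<bar> \<le> 1\<close>.\<close>

lemma norm_wedge_int_basis:
  fixes xs :: "(real ^ 'i::finite) list"
  assumes xs: "int_basis xs" "xs \<noteq> []"
  shows "norm (wedge_list xs) = height (span (set xs))"
proof -
  let ?W = "wedge_list xs" and ?V = "span (set xs)"
  have W: "?W \<noteq> 0" "int_vec ?W" using xs(1) by (auto simp: int_basis_def int_vec_wedge_list)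
  have "dim ?V \<noteq> 0" using wedge_list_length[OF W(1)] xs(2) by (metis length_0_conv)
  then have V: "?V \<noteq> {0}" by (metis dim_singleton)
  obtain X where X: "X \<in> plucker_coords ?V" "primitive X" "height ?V = norm X"
    using primitive_plucker_exists[OF int_basis_plucker[OF xs(1)] W(2) V] .
  obtain c where c: "c \<noteq> 0" "?W = c *\<^sub>R X"
    using plucker_coords_proportional[OF X(1) int_basis_plucker[OF xs(1)]] .
  define m where "m = DIM(real ^ 'i) - length xs"
  have "length xs \<le> DIM(real ^ 'i)" using wedge_list_length[OF W(1)] dim_subset_UNIV by metis
  then have "dim (UNIV :: (real ^ 'i) set) = length xs + m" by (simp add: m_def dim_UNIV)
  then obtain G where G: "G 0 = xs" "\<forall>i\<le>m. int_basis (G i) \<and> length (G i) = length xs + i"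
    "\<forall>i<m. \<exists>p. extends_minimally (\<lambda>a. a) UNIV p (G i) \<and> G (Suc i) = p # G i"
    using int_basis_chain[of "\<lambda>a. a" 1 xs UNIV m] xs(1) rational_subspace_UNIV by (auto simp: linear_ident)
  have "i \<le> m \<Longrightarrow> \<exists>Z. int_vec Z \<and> wedge_list (G i) = c *\<^sub>R Z" for i
  proof (induction i)
    case 0
    then show ?case using c G(1) primitive_int_vec[OF X(2)] by auto
  next
    case (Suc i)
    then obtain Z where Z: "int_vec Z" "wedge_list (G i) = c *\<^sub>R Z" by auto
    obtain p where p: "int_vec p" "G (Suc i) = p # G i"
      using G(3)[rule_format, of i] Suc.prems by (auto simp: extends_minimally_def)
    then have "wedge_list (G (Suc i)) = c *\<^sub>R ext p Z" by (simp add: Z(2) ext_scaleR_right)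
    then show ?case using int_vec_ext[OF p(1) Z(1)] by blast
  qed
  then obtain Z where Z: "int_vec Z" "wedge_list (G m) = c *\<^sub>R Z" by blast
  have Gm: "int_basis (G m)" "length (G m) = DIM(real ^ 'i)"
    using G(2) \<open>dim UNIV = length xs + m\<close> by (auto simp: dim_UNIV)
  then have "dim (span (set (G m))) = DIM(real ^ 'i)" by (metis int_basis_def wedge_list_length)
  then have "span (set (G m)) = UNIV" by (metis dim_eq_full span_span)
  then have 1: "\<bar>c\<bar> * norm Z = 1" using norm_wedge_int_basis_UNIV[OF Gm(1)] Z(2) by simp
  then have "Z \<noteq> 0" by auto
  then have "\<bar>c\<bar> \<le> 1" using 1 int_vec_norm_ge_1[OF Z(1)] mult_left_mono[of 1 "norm Z" "\<bar>c\<bar>"] by simp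
  then have "norm ?W \<le> height ?V" using c(2) X(3) by (simp add: mult_left_le_one_le)
  then show ?thesis using height_le[OF int_basis_plucker[OF xs(1)] W(2) V] by simp
qed

section \<open>Lattice reduction\<close>

lemma squeeze_grassmann_one [simp]: "squeeze u e grassmann_one = grassmann_one"
  by (simp add: squeeze_def)

text \<open>The Siegel condition of lattice reduction.\<close>

lemma extends_minimally_twice:
  fixes xs :: "(real ^ 'i::finite) list"
  assumes V: "subspace V"
    and p: "extends_minimally (squeeze u e) V p xs"
    and q: "extends_minimally (squeeze u e) V q (p # xs)"
  shows "(norm (squeeze u e (wedge_list (p # xs))))\<^sup>2 \<le>
    2 * norm (squeeze u e (wedge_list (q # p # xs))) * norm (squeeze u e (wedge_list xs))"
proof -
  define T where "T x = x + ((e - 1) * (x \<bullet> u)) *\<^sub>R u" for x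
  define W where "W = wedge_list (map T xs)"
  have sq: "squeeze u e (wedge_list xs) = W" "squeeze u e (ext x a) = ext (T x) (squeeze u e a)" for x a
    by (simp_all add: W_def T_def[abs_def] squeeze_wedge_list squeeze_ext)
  define A B where "A = ext (T p) W" and "B = ext (T q) W"
  \<comment> \<open>Size reduction: after squeezing and factoring out the span, \<open>t\<close> is
    the integer nearest to the Gram-Schmidt coefficient of \<open>q\<close> along \<open>p\<close>.
    So \<open>r\<close> has the same product with \<open>p\<close> as \<open>q\<close>, but a small
    component along it.\<close>
  define t where "t = round (A \<bullet> B / (norm A)\<^sup>2)"
  define r where "r = q - of_int t *\<^sub>R p"
  define C where "C = ext (T r) W"
  have T_r: "T r = T q - of_int t *\<^sub>R T p" by (simp add: T_def r_def inner_diff_left algebra_simps)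
  have C: "C = B - of_int t *\<^sub>R A"
    by (simp add: C_def T_r A_def B_def linear_diff[OF linear_ext_left] ext_scaleR_left)
  have r: "int_vec r" "r \<in> V" "r \<notin> span (set xs)"
  proof -
    show "int_vec r" unfolding r_def
      by (intro int_vec_diff int_vec_scaleR) (use p q in \<open>auto simp: extends_minimally_def\<close>)
    show "r \<in> V" unfolding r_def
      by (intro subspace_diff subspace_scale V) (use p q in \<open>auto simp: extends_minimally_def\<close>)
    show "r \<notin> span (set xs)"
    proof
      assume "r \<in> span (set xs)"
      then have "q \<in> span (insert p (set xs))" by (auto simp: r_def span_breakdown_eq)
      then show False using q by (simp add: extends_minimally_def)
    qed
  qed
  have AC: "norm A \<le> norm C"
    using p r by (simp add: extends_minimally_def sq A_def C_def)
  have "\<bar>A \<bullet> C\<bar> \<le> (norm A)\<^sup>2 / 2"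
  proof (cases "A = 0")
    case False
    have "\<bar>A \<bullet> B / (norm A)\<^sup>2 - of_int t\<bar> \<le> 1 / 2"
      unfolding t_def using of_int_round_abs_le abs_minus_commute by metis
    then have "\<bar>A \<bullet> B / (norm A)\<^sup>2 - of_int t\<bar> * (norm A)\<^sup>2 \<le> 1 / 2 * (norm A)\<^sup>2"
      by (rule mult_right_mono) simp
    moreover have "A \<bullet> C = (A \<bullet> B / (norm A)\<^sup>2 - of_int t) * (norm A)\<^sup>2"
      using False by (simp add: C inner_diff_right power2_norm_eq_inner field_simps)
    ultimately show ?thesis by (simp add: abs_mult)
  qed simp
  then have "(A \<bullet> C)\<^sup>2 \<le> ((norm A)\<^sup>2 / 2)\<^sup>2" by (metis power2_abs power_mono abs_ge_zero)
  then have bound: "(A \<bullet> C)\<^sup>2 \<le> (norm A)\<^sup>2 * (norm A)\<^sup>2 / 4" by (simp add: power2_eq_square)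
  have le: "(norm A)\<^sup>2 * (norm A)\<^sup>2 \<le> (norm A)\<^sup>2 * (norm C)\<^sup>2"
    using AC by (intro mult_left_mono power_mono) auto
  have gram: "(norm (ext (T r) A))\<^sup>2 * (norm W)\<^sup>2 = (norm A)\<^sup>2 * (norm C)\<^sup>2 - (A \<bullet> C)\<^sup>2"
    unfolding A_def C_def W_def by (rule gram_ext_wedge_list)
  have eq: "ext (T r) A = ext (T q) A"
    by (simp add: T_r A_def linear_diff[OF linear_ext_left] ext_scaleR_left)
  \<comment> \<open>Gram's identity even leaves three quarters of the fourth power of
    \<open>norm A\<close>; a quarter is enough and makes the constant 2.\<close>
  have "(norm A)\<^sup>2 * (norm A)\<^sup>2 \<le> 4 * ((norm (ext (T q) A))\<^sup>2 * (norm W)\<^sup>2)"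
  proof -
    have "a * a \<le> 4 * x" if "s \<le> a * a / 4" "a * a \<le> y" "x = y - s" for a s x y :: real
      using that zero_le_square[of a] by linarith
    from this[OF bound le gram] show ?thesis unfolding eq .
  qed
  then have "((norm A)\<^sup>2)\<^sup>2 \<le> (2 * norm (ext (T q) A) * norm W)\<^sup>2"
    by (simp add: power2_eq_square mult_ac)
  then have "(norm A)\<^sup>2 \<le> 2 * norm (ext (T q) A) * norm W" by (rule power2_le_imp_le) simp
  then show ?thesis by (simp add: sq A_def)
qed

text \<open>The ratios of consecutive terms increase up to a factor 2 at each step, and their
  product telescopes to \<open>v m / v 0\<close>. Comparing all of them with the first, respectively
  the last, gives the two bounds; \<open>2 ^ m\<close> dominates the accumulated factors.\<close>

lemma log_convex_ratio_bounds:
  fixes v :: "nat \<Rightarrow> real"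
  assumes pos: "\<And>i. i \<le> m \<Longrightarrow> 0 < v i"
    and conv: "\<And>i. i + 2 \<le> m \<Longrightarrow> (v (i + 1))\<^sup>2 \<le> 2 * v (i + 2) * v i"
    and m: "0 < m"
  shows "(v 1 / v 0 / 2 ^ m) ^ m \<le> v m / v 0"
    and "v m / v 0 \<le> (2 ^ m * (v m / v (m - 1))) ^ m"
proof -
  define r where "r i = v (Suc i) / v i" for i
  have r_pos: "0 < r i" if "i < m" for i using pos that by (simp add: r_def)
  have step: "r i \<le> 2 * r (Suc i)" if "Suc i < m" for i
    using conv[of i] pos[of i] pos[of "Suc i"] that by (simp add: r_def field_simps power2_eq_square)
  have mono: "r i \<le> 2 ^ n * r (i + n)" if "i + n < m" for i n
    using that
  proof (induction n)
    case (Suc n)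
    then have "r i \<le> 2 ^ n * r (i + n)" by simp
    also have "\<dots> \<le> 2 ^ n * (2 * r (Suc (i + n)))" using step Suc.prems by (intro mult_left_mono) auto
    finally show ?case by (simp add: mult_ac)
  qed simp
  have le: "r i \<le> 2 ^ m * r j" if "i \<le> j" "j < m" for i j
  proof -
    have "r i \<le> 2 ^ (j - i) * r j" using mono[of i "j - i"] that by simp
    also have "\<dots> \<le> 2 ^ m * r j" using that r_pos[of j] by (intro mult_right_mono power_increasing) auto
    finally show ?thesis .
  qed
  have prod: "n \<le> m \<Longrightarrow> (\<Prod>i<n. r i) = v n / v 0" for n
  proof (induction n)
    case (Suc n)
    then show ?case using pos[of n] by (simp add: r_def)
  qed (use pos[of 0] in simp)
  have "(\<Prod>i<m. r 0 / 2 ^ m) \<le> (\<Prod>i<m. r i)"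
    using le[of 0] r_pos[OF m] by (intro prod_mono) (auto simp: field_simps)
  then show "(v 1 / v 0 / 2 ^ m) ^ m \<le> v m / v 0" using prod[of m] by (simp add: r_def)
  have "(\<Prod>i<m. r i) \<le> (\<Prod>i<m. 2 ^ m * r (m - 1))"
    using le[of _ "m - 1"] r_pos m by (intro prod_mono) (auto simp: less_imp_le)
  then show "v m / v 0 \<le> (2 ^ m * (v m / v (m - 1))) ^ m" using prod[of m] m by (simp add: r_def)
qed

text \<open>Hermite's argument: the Siegel condition makes the squeezed norms nearly log-convex. The
  first ratio serves for enlarging a subspace, the last for shrinking it.\<close>

lemma chain_bounds:
  fixes G :: "nat \<Rightarrow> (real ^ 'i::finite) list"
  assumes u: "norm u = 1" "0 < e" "e \<le> 1" and V: "subspace V" and m: "0 < m"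
    and G: "\<forall>i\<le>m. int_basis (G i)"
      "\<forall>i<m. \<exists>p. extends_minimally (squeeze u e) V p (G i) \<and> G (Suc i) = p # G i"
  defines "v \<equiv> \<lambda>i. norm (squeeze u e (wedge_list (G i)))"
  shows "\<forall>i\<le>m. 0 < v i"
    and "(v 1 / v 0 / 2 ^ m) ^ m \<le> v m / v 0"
    and "v m / v 0 \<le> (2 ^ m * (v m / v (m - 1))) ^ m"
proof -
  have pos: "0 < v i" if "i \<le> m" for i
  proof -
    have "0 < e * norm (wedge_list (G i))" using G(1) that u(2) by (simp add: int_basis_def)
    then show ?thesis unfolding v_def using norm_squeeze_bounds(1)[OF u] by (rule less_le_trans)
  qed
  then show "\<forall>i\<le>m. 0 < v i" by blast
  have conv: "(v (i + 1))\<^sup>2 \<le> 2 * v (i + 2) * v i" if i: "i + 2 \<le> m" for i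
  proof -
    obtain p where p: "extends_minimally (squeeze u e) V p (G i)" "G (Suc i) = p # G i"
      using G(2)[rule_format, of i] i by auto
    obtain q where q: "extends_minimally (squeeze u e) V q (G (Suc i))" "G (Suc (Suc i)) = q # G (Suc i)"
      using G(2)[rule_format, of "Suc i"] i by auto
    show ?thesis using extends_minimally_twice[OF V p(1), of q] p(2) q by (simp add: v_def)
  qed
  show "(v 1 / v 0 / 2 ^ m) ^ m \<le> v m / v 0" "v m / v 0 \<le> (2 ^ m * (v m / v (m - 1))) ^ m"
    using log_convex_ratio_bounds[OF pos conv m] by auto
qed

section \<open>Exponents\<close>

lemma le_powr_inverse:
  fixes x y :: real
  assumes "0 \<le> x" "x ^ m \<le> y" "0 < m"
  shows "x \<le> y powr (1 / real m)"
proof (cases "x = 0")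
  case False
  then have "x = (x ^ m) powr (1 / real m)"
    using assms by (simp add: powr_powr flip: powr_realpow)
  also have "\<dots> \<le> y powr (1 / real m)" using assms by (intro powr_mono2) auto
  finally show ?thesis .
qed simp

lemma powr_mult_less_if_large:
  fixes C w \<eta> :: real
  assumes "0 < C" "0 < w" "0 < \<eta>"
  obtains M where "0 < M" "\<And>h. M < h \<Longrightarrow> C * h powr (- w) < \<eta>"
proof (rule that)
  show "0 < (\<eta> / C) powr (- 1 / w)" using assms by simp
  fix h assume "(\<eta> / C) powr (- 1 / w) < h"
  then have "h powr (- w) < ((\<eta> / C) powr (- 1 / w)) powr (- w)"
    using assms by (intro powr_less_mono2_neg) auto
  also have "\<dots> = \<eta> / C" using assms by (simp add: powr_powr)
  finally show "C * h powr (- w) < \<eta>" using assms(1) by (simp add: field_simps)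
qed

text \<open>Re-expresses a decay in the old height \<open>h\<close> as a decay in the new height
  \<open>h'\<close>; a negative exponent reverses the assumed bound.\<close>

lemma powr_le_of_le_mult_powr:
  fixes h h' K a b :: real
  assumes "0 < h'" "0 < h" "h' \<le> K * h powr a" "0 < K" "0 < a" "0 \<le> b"
  shows "h powr (- b) \<le> K powr (b / a) * h' powr (- b / a)"
proof -
  have "h powr (- b) = (h powr a) powr (- b / a)" using assms by (simp add: powr_powr)
  also have "\<dots> \<le> (h' / K) powr (- b / a)"
    using assms by (intro powr_mono2') (auto simp: field_simps)
  also have "\<dots> = K powr (b / a) * h' powr (- b / a)"
    using assms by (simp add: powr_divide powr_minus_divide)
  finally show ?thesis .
qed

section \<open>Rational subspaces of bounded height\<close>

lemma rational_height_basis: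
  assumes "rational_subspace V" "V \<noteq> {0}"
  obtains xs where "int_basis xs" "span (set xs) = V" "wedge_list xs \<in> plucker_coords V"
    "int_vec (wedge_list xs)" "norm (wedge_list xs) = height V" "1 \<le> height V"
proof -
  obtain xs where xs: "int_basis xs" "span (set xs) = V" using int_basis_exists assms(1) .
  then have "xs \<noteq> []" using assms(2) by auto
  then have "norm (wedge_list xs) = height V" using norm_wedge_int_basis xs by blast
  moreover have "int_vec (wedge_list xs)" "wedge_list xs \<noteq> 0"
    using xs(1) by (auto simp: int_basis_def int_vec_wedge_list)
  ultimately show ?thesis using that[OF xs] int_basis_plucker[OF xs(1)] xs(2) int_vec_norm_ge_1 by metis
qed

lemma height_ge_1: "rational_subspace V \<Longrightarrow> V \<noteq> {0} \<Longrightarrow> 1 \<le> height V"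
  using rational_height_basis by blast

text \<open>Northcott's finiteness property: \<open>V\<close> is recovered from an integral Pluecker
  vector \<open>W\<close> of norm at most \<open>M\<close> as the kernel of
  \<open>\<lambda>x. ext x W\<close>.\<close>

lemma finite_height_le: "finite {V :: (real ^ 'i::finite) set. rational_subspace V \<and> V \<noteq> {0} \<and> height V \<le> M}"
proof (rule finite_subset)
  show "{V. rational_subspace V \<and> V \<noteq> {0} \<and> height V \<le> M} \<subseteq>
      (\<lambda>W :: 'i grassmann. {x. ext x W = 0}) ` {W. int_vec W \<and> norm W \<le> M}"
  proof
    fix V :: "(real ^ 'i) set"
    assume "V \<in> {V. rational_subspace V \<and> V \<noteq> {0} \<and> height V \<le> M}"
    then have V: "rational_subspace V" "V \<noteq> {0}" "height V \<le> M" by auto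
    obtain xs where xs: "int_basis xs" "span (set xs) = V" "int_vec (wedge_list xs)"
      "norm (wedge_list xs) = height V"
      using rational_height_basis[OF V(1,2)] by metis
    have "wedge_list xs \<noteq> 0" using xs(1) by (simp add: int_basis_def)
    then have "V = {x. ext x (wedge_list xs) = 0}"
      by (simp add: ext_wedge_list_eq_0_iff xs(2))
    then show "V \<in> (\<lambda>W. {x. ext x W = 0}) ` {W. int_vec W \<and> norm W \<le> M}"
      by (rule image_eqI) (use xs V(3) in simp)
  qed
qed (intro finite_imageI finite_int_vec_bounded)

section \<open>Enlarging and shrinking a rational subspace\<close>

lemma subspace_extension_small_height:
  fixes V :: "(real ^ 'i::finite) set"
  assumes V: "rational_subspace V" "V \<noteq> {0}" and m: "dim V + m = CARD('i)" "0 < m"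
  obtains V' where "rational_subspace V'" "V \<subseteq> V'" "dim V' = dim V + 1"
    "height V' \<le> 2 ^ m * height V powr (1 - 1 / real m)"
proof -
  \<comment> \<open>With factor 1 the squeeze is the identity, so any unit vector will do
    here.\<close>
  define u :: "real ^ 'i" where "u = axis undefined 1"
  have u: "norm u = 1" by (simp add: u_def)
  obtain xs where xs: "int_basis xs" "span (set xs) = V" "norm (wedge_list xs) = height V" "1 \<le> height V"
    using rational_height_basis[OF V] .
  let ?H = "height V"
  have len: "length xs = dim V" using xs(1,2) wedge_list_length by (auto simp: int_basis_def)
  have dimU: "dim (UNIV :: (real ^ 'i) set) = length xs + m" using m len by (simp add: dim_UNIV)
  obtain G where G: "G 0 = xs" "\<forall>i\<le>m. int_basis (G i) \<and> length (G i) = length xs + i"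
    "\<forall>i<m. \<exists>p. extends_minimally (squeeze u 1) UNIV p (G i) \<and> G (Suc i) = p # G i"
    using int_basis_chain[of "squeeze u 1" 1 xs UNIV m, OF linear_squeeze _ _ xs(1) _ rational_subspace_UNIV dimU]
    by auto
  define v where "v i = norm (wedge_list (G i))" for i
  have Gm: "int_basis (G m)" "length (G m) = CARD('i)" using G(2) m len by auto
  then have "dim (span (set (G m))) = DIM(real ^ 'i)" by (metis DIM_cart DIM_real int_basis_def mult.right_neutral wedge_list_length)
  then have "span (set (G m)) = UNIV" by (metis dim_eq_full span_span)
  then have vm: "v m = 1" unfolding v_def using norm_wedge_int_basis_UNIV Gm(1) by blast
  have v0: "v 0 = ?H" by (simp add: v_def G(1) xs(3))
  \<comment> \<open>The chain runs from \<open>height V\<close> to 1 in \<open>m\<close> steps, so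
    its first ratio is at most \<open>2 ^ m\<close> times the geometric mean.\<close>
  have "(v 1 / v 0 / 2 ^ m) ^ m \<le> v m / v 0"
    using chain_bounds(2)[OF u zero_less_one order_refl subspace_UNIV m(2) _ G(3)] G(2) by (simp add: v_def)
  then have "(v 1 / ?H / 2 ^ m) ^ m \<le> 1 / ?H" by (simp only: v0 vm)
  then have "v 1 / ?H / 2 ^ m \<le> (1 / ?H) powr (1 / real m)"
    by (intro le_powr_inverse m(2)) (use xs(4) in \<open>auto simp: v_def\<close>)
  then have "v 1 \<le> 2 ^ m * (?H * (1 / ?H) powr (1 / real m))" using xs(4) by (simp add: field_simps)
  also have "?H * (1 / ?H) powr (1 / real m) = ?H powr (1 - 1 / real m)"
    using xs(4) by (simp add: powr_diff powr_divide)
  finally have v1: "v 1 \<le> 2 ^ m * ?H powr (1 - 1 / real m)" .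
  obtain p where p: "G 1 = p # xs" using G(1,3) m(2) by auto
  have G1: "int_basis (G 1)" "length (G 1) = dim V + 1" using G(2) m(2) len by auto
  show ?thesis
  proof (rule that)
    show "rational_subspace (span (set (G 1)))"
      using G1(1) by (intro rational_subspace_int_span) (simp add: int_basis_def)
    show "V \<subseteq> span (set (G 1))" unfolding xs(2)[symmetric] p by (intro span_mono) auto
    show "dim (span (set (G 1))) = dim V + 1" using G1 wedge_list_length by (metis int_basis_def)
    show "height (span (set (G 1))) \<le> 2 ^ m * ?H powr (1 - 1 / real m)"
      using norm_wedge_int_basis[OF G1(1)] p v1 by (simp add: v_def)
  qed
qed

text \<open>Squeezed by \<open>e\<close> along \<open>u\<close>, the chain goes from 1 to at most
  \<open>2 * e * height V\<close> in \<open>k\<close> steps. Its last ratio cannot be much below the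
  geometric mean; this bounds the last but one norm, which dominates both quantities in the
  conclusion.\<close>

lemma subspace_hyperplane_near:
  fixes V :: "(real ^ 'i::finite) set"
  assumes V: "rational_subspace V" "dim V = k" "2 \<le> k" and u: "u \<noteq> 0"
    and e: "0 < e" "e \<le> 1" "proj_dist_subspace u V \<le> e"
  defines "B \<equiv> 2 ^ k * (2 * e * height V) powr (1 - 1 / real k)"
  obtains V' where "rational_subspace V'" "dim V' = k - 1" "e * height V' \<le> B"
    "proj_dist_subspace u V' * height V' \<le> B"
proof -
  define w where "w = (1 / norm u) *\<^sub>R u"
  have w: "norm w = 1" using u by (simp add: w_def)
  have norm_ext_w: "norm (ext w X) = proj_dist_subspace u V' * norm X"
    if "X \<in> plucker_coords V'" "V' \<noteq> {0}" for X V'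
  proof -
    have "X \<noteq> 0" using that(1) by (auto simp: plucker_coords_iff)
    then show ?thesis using proj_dist_subspace_eq[OF that u] u by (simp add: w_def ext_scaleR_left)
  qed
  have V0: "V \<noteq> {0}" using V(2,3) by auto
  have sV: "subspace V" using V(1) by (auto simp: rational_subspace_def)
  have k: "0 < k" using V(3) by simp
  obtain G where G: "G 0 = []" "\<forall>i\<le>k. int_basis (G i) \<and> set (G i) \<subseteq> V \<and> length (G i) = i"
    "\<forall>i<k. \<exists>p. extends_minimally (squeeze w e) V p (G i) \<and> G (Suc i) = p # G i"
    using int_basis_chain[of "squeeze w e" e "[]" V k, OF linear_squeeze e(1) norm_squeeze_bounds(1)[OF w e(1,2)] int_basis_Nil _ V(1)] V(2)
    by auto
  define v where "v i = norm (squeeze w e (wedge_list (G i)))" for i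
  note cb = chain_bounds[OF w e(1,2) sV k _ G(3), folded v_def]
  have ib: "\<forall>i\<le>k. int_basis (G i)" using G(2) by blast
  have span_dim: "dim (span (set (G i))) = i" if "i \<le> k" for i
    using G(2) that wedge_list_length by (metis int_basis_def)
  have height: "norm (wedge_list (G i)) = height (span (set (G i)))" "span (set (G i)) \<noteq> {0}" if "i \<le> k" "0 < i" for i
  proof -
    show "norm (wedge_list (G i)) = height (span (set (G i)))"
      using G(2) that by (intro norm_wedge_int_basis) auto
    show "span (set (G i)) \<noteq> {0}" using span_dim that by (metis dim_singleton less_irrefl)
  qed
  have "span (set (G k)) = V"
    using G(2) sV span_dim[of k] V(2) by (intro subspace_dim_equal span_minimal) auto
  moreover have "v k \<le> norm (ext w (wedge_list (G k))) + e * norm (wedge_list (G k))"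
    unfolding v_def by (rule norm_squeeze_bounds(3)[OF w e(1,2)])
  moreover have "wedge_list (G k) \<in> plucker_coords (span (set (G k)))"
    using ib int_basis_plucker by blast
  ultimately have "v k \<le> (proj_dist_subspace u V + e) * height V"
    using height[of k] k norm_ext_w by (simp add: algebra_simps)
  \<comment> \<open>The factor 2 collects the distance and the squeeze factor, each at most
    \<open>e\<close>.\<close>
  also have "\<dots> \<le> (2 * e) * height V"
    using e height_ge_1[OF V(1) V0] by (intro mult_right_mono) auto
  finally have vk: "v k \<le> 2 * e * height V" .
  have vpos: "0 < v k" "0 < v (k - 1)" using cb(1)[OF ib] by auto
  have v0: "v 0 = 1" by (simp add: v_def G(1))
  \<comment> \<open>Both sides are written as \<open>k\<close>-th powers so that the root can be
    taken.\<close>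
  have "(v k powr (1 / real k)) ^ k = v k" using vpos k by (simp add: powr_powr flip: powr_realpow)
  then have "(v k powr (1 / real k)) ^ k \<le> (2 ^ k * (v k / v (k - 1))) ^ k" using cb(3)[OF ib] v0 by simp
  then have "v k powr (1 / real k) \<le> 2 ^ k * (v k / v (k - 1))"
    by (rule power_le_imp_le_base[of _ "k - 1", simplified Suc_diff_1[OF k]]) (use vpos in simp)
  then have "v (k - 1) \<le> 2 ^ k * (v k / v k powr (1 / real k))" using vpos by (simp add: field_simps)
  also have "v k / v k powr (1 / real k) = v k powr (1 - 1 / real k)" using vpos by (simp add: powr_diff)
  also have "2 ^ k * \<dots> \<le> B"
    unfolding B_def using vk vpos k by (intro mult_left_mono powr_mono2) (auto simp: field_simps)
  finally have vB: "v (k - 1) \<le> B" .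
  let ?V = "span (set (G (k - 1)))"
  have i: "k - 1 \<le> k" "0 < k - 1" using V(3) by auto
  show ?thesis
  proof (rule that)
    show "rational_subspace ?V"
      using ib[rule_format, OF i(1)] by (intro rational_subspace_int_span) (simp add: int_basis_def)
    show "dim ?V = k - 1" using span_dim i by blast
    show "e * height ?V \<le> B"
      using norm_squeeze_bounds(1)[OF w e(1,2), of "wedge_list (G (k - 1))"] vB height(1)[OF i] by (simp add: v_def)
    have "wedge_list (G (k - 1)) \<in> plucker_coords ?V" using ib i(1) int_basis_plucker by blast
    then show "proj_dist_subspace u ?V * height ?V \<le> B"
      using norm_squeeze_bounds(2)[OF w e(1,2), of "wedge_list (G (k - 1))"] vB height[OF i] norm_ext_w by (simp add: v_def)
  qed
qed

section \<open>Positivity and monotonicity of the distance\<close>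

lemma homog_nonzero: "homog \<Theta> \<noteq> 0"
proof
  assume "homog \<Theta> = 0"
  then have "homog \<Theta> $ None = 0" by simp
  then show False by (simp add: homog_def)
qed

lemma rat_independent_Ints:
  assumes "rat_independent f" "\<And>i. c i \<in> \<int>" "(\<Sum>i\<in>UNIV. c i * f i) = 0"
  shows "c i = 0"
proof -
  have "\<exists>w. c i = of_int w" for i using assms(2)[of i] by (auto elim: Ints_cases)
  then obtain z where z: "\<And>i. c i = of_int (z i)" by metis
  then have "(\<Sum>i\<in>UNIV. of_rat (of_int (z i)) * f i) = 0" using assms(3) by simp
  then have "of_int (z i) = (0 :: rat)"
    using assms(1)[unfolded rat_independent_def, rule_format, of "\<lambda>i. of_int (z i)" i] by simp
  then show ?thesis by (simp add: z)
qed

text \<open>If the product of \<open>u\<close> with the Pluecker vector vanishes, each coordinate is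
  an integer relation among the coordinates of \<open>u\<close>. All coefficients then vanish, so
  every vector annihilates the Pluecker vector and \<open>V\<close> is the whole space.\<close>

lemma proj_dist_subspace_pos:
  fixes u :: "real ^ 'i::finite"
  assumes u: "rat_independent (\<lambda>i. u $ i)" "u \<noteq> 0"
    and V: "rational_subspace V" "V \<noteq> {0}" "V \<noteq> UNIV"
  shows "0 < proj_dist_subspace u V"
proof -
  obtain xs where xs: "int_basis xs" "span (set xs) = V" "wedge_list xs \<in> plucker_coords V"
    "int_vec (wedge_list xs)"
    using rational_height_basis[OF V(1,2)] .
  let ?X = "wedge_list xs"
  have X0: "?X \<noteq> 0" using xs(1) by (simp add: int_basis_def)
  have "ext u ?X \<noteq> 0"
  proof
    assume *: "ext u ?X = 0"
    have zero: "?X $ (K - {i}) = 0" if "i \<in> K" for K i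
    proof -
      define c where "c j = (if j \<in> K then shuffle_sign {j} (K - {j}) * ?X $ (K - {j}) else 0)" for j
      have "(\<Sum>j\<in>UNIV. c j * u $ j) = ext u ?X $ K"
        unfolding ext_nth c_def by (rule sum.mono_neutral_cong_right) (auto simp: mult_ac)
      then have "(\<Sum>j\<in>UNIV. c j * u $ j) = 0" using * by simp
      moreover have "c j \<in> \<int>" for j
        using xs(4) by (auto simp: c_def int_vec_def shuffle_sign_def intro!: Ints_mult Ints_power)
      ultimately have "c i = 0" using rat_independent_Ints[OF u(1)] by blast
      then show ?thesis using that by (simp add: c_def shuffle_sign_singleton)
    qed
    have "ext x ?X = 0" for x by (simp add: vec_eq_iff ext_nth zero)
    then have "V = UNIV" using X0 xs(2) by (auto simp: ext_wedge_list_eq_0_iff)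
    then show False using V(3) by blast
  qed
  then show ?thesis using proj_dist_subspace_eq[OF xs(3) V(2) u(2)] X0 u(2) by simp
qed

lemma proj_dist_subspace_antimono:
  assumes "V \<subseteq> V'" "subspace V" "V \<noteq> {0}"
  shows "proj_dist_subspace u V' \<le> proj_dist_subspace u V"
  unfolding proj_dist_subspace_def
proof (rule cINF_superset_mono)
  show "V - {0} \<noteq> {}" using assms(2,3) subspace_0 by blast
  show "bdd_below (proj_dist u ` (V' - {0}))"
    by (rule bdd_belowI[of _ 0]) (auto simp: proj_dist_def)
qed (use assms in auto)

section \<open>Exponents and infinite families\<close>

definition approximants :: "nat \<Rightarrow> real ^ 'n::finite \<Rightarrow> real \<Rightarrow> (real ^ 'n option) set set" where
  "approximants d \<Theta> w = {V. rational_subspace V \<and> dim V = d + 1 \<and>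
     proj_dist_subspace (homog \<Theta>) V \<le> height V powr (- 1 - w)}"

lemma approx_exponent_eq:
  "approx_exponent d \<Theta> = Sup {ereal w | w. infinite (approximants d \<Theta> w)}"
  by (simp add: approx_exponent_def approximants_def)

lemma approx_exponent_upper: "infinite (approximants d \<Theta> w) \<Longrightarrow> ereal w \<le> approx_exponent d \<Theta>"
  unfolding approx_exponent_eq by (intro Sup_upper) blast

lemma approx_exponent_least:
  "(\<And>w. infinite (approximants d \<Theta> w) \<Longrightarrow> ereal w \<le> t) \<Longrightarrow> approx_exponent d \<Theta> \<le> t"
  unfolding approx_exponent_eq by (intro Sup_least) blast

lemma dim_Suc_nonzero: "dim V = d + 1 \<Longrightarrow> V \<noteq> {0}"
  for V :: "(real ^ 'i::finite) set"
  by auto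

lemma approximants_unbounded:
  assumes "infinite (approximants d \<Theta> w)"
  obtains V where "V \<in> approximants d \<Theta> w" "M < height V"
proof -
  have "\<not> approximants d \<Theta> w \<subseteq> {V. rational_subspace V \<and> V \<noteq> {0} \<and> height V \<le> M}"
    using assms finite_height_le finite_subset by blast
  then show ?thesis using that by (force simp: approximants_def)
qed

text \<open>Distances are positive, so arbitrarily small ones force infinitely many subspaces. The
  constant \<open>C\<close> is absorbed by any loss \<open>w - r > 0\<close> in the exponent once
  the height is large.\<close>

lemma approx_exponent_ge:
  fixes \<Theta> :: "real ^ 'n::finite"
  assumes ind: "rat_independent (\<lambda>i. homog \<Theta> $ i)" and d: "d + 1 \<le> CARD('n)" and C: "0 < C"
    and approx: "\<And>\<eta>. 0 < \<eta> \<Longrightarrow> \<exists>V. rational_subspace V \<and> dim V = d + 1 \<and>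
      proj_dist_subspace (homog \<Theta>) V \<le> C * height V powr (- 1 - w) \<and> proj_dist_subspace (homog \<Theta>) V < \<eta>"
  shows "ereal w \<le> approx_exponent d \<Theta>"
proof -
  let ?D = "proj_dist_subspace (homog \<Theta>)"
  define F where "F = {V. rational_subspace V \<and> dim V = d + 1 \<and> ?D V \<le> C * height V powr (- 1 - w)}"
  have pos: "0 < ?D V" if "V \<in> F" for V
  proof (rule proj_dist_subspace_pos[OF ind homog_nonzero])
    show "rational_subspace V" "V \<noteq> {0}" "V \<noteq> UNIV"
      using that d dim_UNIV[where 'a = "real ^ 'n option"] by (auto simp: F_def)
  qed
  have "infinite F"
  proof
    assume fin: "finite F"
    \<comment> \<open>The element 1 keeps the minimum defined when \<open>F\<close> is
      empty.\<close>
    have "0 < Min (insert 1 (?D ` F))" using fin pos by simp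
    then obtain V where "V \<in> F" "?D V < Min (insert 1 (?D ` F))" using approx unfolding F_def by blast
    moreover from this have "Min (insert 1 (?D ` F)) \<le> ?D V" using fin by (intro Min_le) auto
    ultimately show False by linarith
  qed
  have "ereal r \<le> approx_exponent d \<Theta>" if r: "r < w" for r
  proof (rule approx_exponent_upper)
    \<comment> \<open>Chosen so that \<open>M powr (w - r) = C\<close>.\<close>
    define M where "M = C powr (1 / (w - r))"
    have "infinite (F - {V. rational_subspace V \<and> V \<noteq> {0} \<and> height V \<le> M})"
      using \<open>infinite F\<close> finite_height_le Diff_infinite_finite by blast
    moreover have "F - {V. rational_subspace V \<and> V \<noteq> {0} \<and> height V \<le> M} \<subseteq> approximants d \<Theta> r"
    proof
      fix V assume V: "V \<in> F - {V. rational_subspace V \<and> V \<noteq> {0} \<and> height V \<le> M}"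
      then have V': "rational_subspace V" "dim V = d + 1" "?D V \<le> C * height V powr (- 1 - w)"
        by (auto simp: F_def)
      have M: "M < height V" using V V' dim_Suc_nonzero by (auto simp: not_le)
      have "0 < M" using C by (simp add: M_def)
      have "C = M powr (w - r)" using C r by (simp add: M_def powr_powr)
      also have "\<dots> \<le> height V powr (w - r)" using M \<open>0 < M\<close> r by (intro powr_mono2) auto
      finally have "C * height V powr (- 1 - w) \<le> height V powr (w - r) * height V powr (- 1 - w)"
        by (intro mult_right_mono) auto
      also have "\<dots> = height V powr (- 1 - r)" by (simp add: algebra_simps flip: powr_add)
      finally show "V \<in> approximants d \<Theta> r" using V' by (simp add: approximants_def)
    qed
    ultimately show "infinite (approximants d \<Theta> r)" using infinite_super by blast
  qed
  then have "x \<le> approx_exponent d \<Theta>" if "x < ereal w" for x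
    using that by (cases x) auto
  then show ?thesis by (rule dense_le)
qed

section \<open>Lower bounds for the exponents\<close>

text \<open>Rounding \<open>real q\<close> times the homogeneous coordinates moves them by a bounded
  amount, so the distance is at most a constant over the height. This weak form of Dirichlet's
  theorem starts the induction in \<open>approx_exponent_nonneg\<close>.\<close>

lemma approx_exponent_0_nonneg:
  fixes \<Theta> :: "real ^ 'n::finite"
  assumes ind: "rat_independent (\<lambda>i. homog \<Theta> $ i)"
  shows "0 \<le> approx_exponent 0 \<Theta>"
proof -
  define N where "N = real CARD('n option)"
  have N: "0 < N" by (simp add: N_def)
  have "ereal 0 \<le> approx_exponent 0 \<Theta>"
  proof (rule approx_exponent_ge[OF ind _ N])
    show "0 + 1 \<le> CARD('n)" by (simp add: Suc_leI)
    fix \<eta> :: real assume \<eta>: "0 < \<eta>"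
    obtain q :: nat where q: "N / \<eta> < real q" using reals_Archimedean2 by blast
    let ?u = "homog \<Theta>"
    define x :: "real ^ 'n option" where "x = (\<chi> i. of_int (round (real q * ?u $ i)))"
    have x_None: "x $ None = real q" by (simp add: x_def homog_def)
    have "0 < q" using q N \<eta> by (metis divide_pos_pos less_trans of_nat_0_less_iff)
    then have x0: "x \<noteq> 0" using x_None by auto
    have xq: "real q \<le> norm x" using component_le_norm_cart[of x None] x_None by simp
    have int: "int_vec x" by (simp add: x_def int_vec_def)
    have X: "wedge_list [x] \<in> plucker_coords (span {x})"
      using x0 wedge_list_nonzero_iff[of "[x]"] unfolding plucker_coords_iff by (intro exI[of _ "[x]"]) auto
    have normX: "norm (wedge_list [x]) = norm x"
      using norm_ext_wedge_list_orthogonal[of x "[]"] by simp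
    have V0: "span {x} \<noteq> {0}" using x0 span_base[of x "{x}"] by auto
    have "norm (x - real q *\<^sub>R ?u) \<le> (\<Sum>i\<in>UNIV. \<bar>(x - real q *\<^sub>R ?u) $ i\<bar>)" by (rule norm_le_l1_cart)
    also have "\<dots> \<le> (\<Sum>i\<in>(UNIV :: 'n option set). 1)"
    proof (rule sum_mono)
      fix i show "\<bar>(x - real q *\<^sub>R ?u) $ i\<bar> \<le> 1"
        using of_int_round_abs_le[of "real q * ?u $ i"] by (simp add: x_def)
    qed
    finally have diff: "norm (x - real q *\<^sub>R ?u) \<le> N" by (simp add: N_def)
    \<comment> \<open>Subtracting a multiple of \<open>?u\<close> from \<open>x\<close> does not
      change the product with \<open>?u\<close>.\<close>
    have "ext ?u (wedge_list [x]) = - ext x (ext ?u grassmann_one)" by (simp add: ext_anticommute[of ?u])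
    also have "\<dots> = - ext (x - real q *\<^sub>R ?u) (ext ?u grassmann_one)"
      by (simp add: linear_diff[OF linear_ext_left] ext_scaleR_left)
    finally have "norm (ext ?u (wedge_list [x])) \<le> norm (x - real q *\<^sub>R ?u) * norm (ext ?u grassmann_one)"
      by (simp add: norm_ext_le)
    also have "\<dots> \<le> N * norm ?u"
      using diff norm_ext_le[of ?u grassmann_one] N by (intro mult_mono) auto
    finally have "proj_dist_subspace ?u (span {x}) \<le> N * norm ?u / (norm ?u * norm x)"
      unfolding proj_dist_subspace_eq[OF X V0 homog_nonzero] normX by (intro divide_right_mono) auto
    then have D: "proj_dist_subspace ?u (span {x}) \<le> N / norm x" using homog_nonzero[of \<Theta>] by simp
    have rat: "rational_subspace (span {x})" using int by (intro rational_subspace_int_span) auto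
    have dim: "dim (span {x}) = 0 + 1" using x0 by simp
    have H: "1 \<le> height (span {x})" "height (span {x}) \<le> norm x"
      using height_ge_1[OF rat V0] height_le[OF X _ V0] int_vec_wedge_list[of "[x]"] int normX by auto
    have "N / norm x \<le> N / height (span {x})" using H N x0 by (intro divide_left_mono mult_pos_pos) auto
    then have "proj_dist_subspace ?u (span {x}) \<le> N * height (span {x}) powr (- 1 - 0)"
      using D H by (simp add: powr_minus_divide)
    moreover have "proj_dist_subspace ?u (span {x}) < \<eta>"
    proof -
      have "N / norm x \<le> N / real q" using xq N x0 \<open>0 < q\<close> by (intro divide_left_mono mult_pos_pos) auto
      also have "\<dots> < \<eta>" using q \<eta> \<open>0 < q\<close> by (simp add: field_simps)
      finally show ?thesis using D by simp
    qed
    ultimately show "\<exists>V. rational_subspace V \<and> dim V = 0 + 1 \<and>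
      proj_dist_subspace ?u V \<le> N * height V powr (- 1 - 0) \<and> proj_dist_subspace ?u V < \<eta>"
      using rat dim by blast
  qed
  then show ?thesis unfolding zero_ereal_def .
qed

text \<open>Enlarging \<open>V\<close> does not increase the distance, while the height becomes at
  most about its power \<open>a\<close>, so \<open>1 + w\<close> turns into
  \<open>(1 + w) / a\<close>.\<close>

lemma approx_exponent_up:
  fixes \<Theta> :: "real ^ 'n::finite"
  assumes ind: "rat_independent (\<lambda>i. homog \<Theta> $ i)" and d: "1 \<le> d" "d + 1 \<le> CARD('n)"
    and inf: "infinite (approximants (d - 1) \<Theta> w)" and w: "- 1 < w"
  shows "ereal (((real CARD('n) - real d + 1) * w + 1) / (real CARD('n) - real d)) \<le> approx_exponent d \<Theta>"
proof -
  let ?u = "homog \<Theta>"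
  \<comment> \<open>The codimension: members of \<open>approximants (d - 1) \<Theta> w\<close> have
    vector space dimension \<open>d\<close> in a space of dimension
    \<open>CARD('n) + 1\<close>.\<close>
  define m where "m = CARD('n) + 1 - d"
  have m: "2 \<le> m" "real m = real CARD('n) - real d + 1" using d by (auto simp: m_def)
  define a where "a = 1 - 1 / real m"
  have a: "0 < a" using m by (simp add: a_def)
  define K :: real where "K = 2 ^ m"
  have K: "0 < K" by (simp add: K_def)
  have "ereal ((1 + w) / a - 1) \<le> approx_exponent d \<Theta>"
  proof (rule approx_exponent_ge[OF ind d(2)])
    show "0 < K powr ((1 + w) / a)" using K by simp
    fix \<eta> :: real assume "0 < \<eta>"
    then obtain M where M: "0 < M" "\<And>h. M < h \<Longrightarrow> 1 * h powr (- (1 + w)) < \<eta>"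
      using powr_mult_less_if_large[of 1 "1 + w" \<eta>] w by auto
    obtain V where V: "V \<in> approximants (d - 1) \<Theta> w" "M < height V"
      using approximants_unbounded[OF inf] .
    then have V': "rational_subspace V" "dim V = d" "proj_dist_subspace ?u V \<le> height V powr (- (1 + w))"
      using d(1) by (auto simp: approximants_def)
    have V0: "V \<noteq> {0}" using V'(2) d(1) by auto
    have "dim V + m = CARD('n option)" using V'(2) d by (simp add: m_def)
    then obtain V' where E: "rational_subspace V'" "V \<subseteq> V'" "dim V' = dim V + 1" "height V' \<le> K * height V powr a"
      using subspace_extension_small_height[OF V'(1) V0, of m] m(1) unfolding K_def a_def by auto
    have sV: "subspace V" using V'(1) by (auto simp: rational_subspace_def)
    have dim: "dim V' = d + 1" using E(3) V'(2) by simp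
    have H': "1 \<le> height V'" using height_ge_1[OF E(1) dim_Suc_nonzero[OF dim]] .
    have le: "proj_dist_subspace ?u V' \<le> height V powr (- (1 + w))"
      using proj_dist_subspace_antimono[OF E(2) sV V0] V'(3) by (rule order_trans)
    also have "\<dots> \<le> K powr ((1 + w) / a) * height V' powr (- (1 + w) / a)"
      using H' V(2) M(1) E(4) K a w by (intro powr_le_of_le_mult_powr) auto
    finally have "proj_dist_subspace ?u V' \<le> K powr ((1 + w) / a) * height V' powr (- 1 - ((1 + w) / a - 1))"
      by (simp add: minus_divide_left)
    moreover have "proj_dist_subspace ?u V' < \<eta>" using le M(2)[OF V(2)] by simp
    ultimately show "\<exists>V. rational_subspace V \<and> dim V = d + 1 \<and>
      proj_dist_subspace ?u V \<le> K powr ((1 + w) / a) * height V powr (- 1 - ((1 + w) / a - 1)) \<and>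
      proj_dist_subspace ?u V < \<eta>" using E(1) dim by blast
  qed
  moreover have "(1 + w) / a - 1 = (real m * w + 1) / (real m - 1)"
    using m(1) by (simp add: a_def field_simps)
  ultimately show ?thesis by (simp add: m(2))
qed

text \<open>Apply \<open>subspace_hyperplane_near\<close> with \<open>e\<close> equal to
  \<open>h powr (- 1 - w)\<close>, where \<open>h = height V\<close>. The new height is at most
  about \<open>h powr a\<close> and its product with the new distance at most about
  \<open>h powr (- b)\<close>, so the new exponent is \<open>b / a\<close>.\<close>

lemma approx_exponent_down:
  fixes \<Theta> :: "real ^ 'n::finite"
  assumes ind: "rat_independent (\<lambda>i. homog \<Theta> $ i)" and d: "1 \<le> d" "d + 1 \<le> CARD('n)"
    and inf: "infinite (approximants d \<Theta> w)" and w: "0 < w"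
  shows "ereal (real d * w / (w + real d + 1)) \<le> approx_exponent (d - 1) \<Theta>"
proof -
  let ?u = "homog \<Theta>"
  define a where "a = (w + real d + 1) / (real d + 1)"
  define b where "b = w * real d / (real d + 1)"
  have d1: "real d + 1 \<noteq> 0" by linarith
  have ab: "0 < a" "0 < b" "1 + w - b = a"
    using w d(1) by (auto simp: a_def b_def field_simps add_pos_pos)
  have ba: "b / a = real d * w / (w + real d + 1)"
    using d1 by (simp add: a_def b_def mult.commute)
  define c where "c = 1 - 1 / real (d + 1)"
  have wc: "w * c = b" by (simp add: c_def b_def field_simps)
  define K :: real where "K = 2 ^ (d + 1) * 2 powr c"
  have K: "0 < K" by (simp add: K_def)
  have "ereal (b / a) \<le> approx_exponent (d - 1) \<Theta>"
  proof (rule approx_exponent_ge[OF ind])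
    show "d - 1 + 1 \<le> CARD('n)" using d by simp
    show "0 < K * K powr (b / a)" using K by simp
    fix \<eta> :: real assume "0 < \<eta>"
    then obtain M where M: "0 < M" "\<And>h. M < h \<Longrightarrow> K * h powr (- b) < \<eta>"
      using powr_mult_less_if_large[OF K ab(2)] by auto
    obtain V where V: "V \<in> approximants d \<Theta> w" "M < height V"
      using approximants_unbounded[OF inf] .
    let ?H = "height V"
    have V': "rational_subspace V" "dim V = d + 1" "proj_dist_subspace ?u V \<le> ?H powr (- 1 - w)"
      using V(1) by (auto simp: approximants_def)
    have H: "1 \<le> ?H" using height_ge_1[OF V'(1) dim_Suc_nonzero[OF V'(2)]] .
    let ?e = "?H powr (- 1 - w)"
    have e: "0 < ?e" "?e \<le> 1" using H w powr_mono[of "- 1 - w" 0 ?H] by auto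
    have "?e * ?H = ?H powr (- w)" using H by (simp add: powr_diff powr_minus_divide field_simps powr_add)
    then have "(2 * ?e * ?H) powr c = 2 powr c * ?H powr (- b)"
      using H by (simp add: mult.assoc powr_mult powr_powr wc)
    then obtain V' where E: "rational_subspace V'" "dim V' = d" "?e * height V' \<le> K * ?H powr (- b)"
      "proj_dist_subspace ?u V' * height V' \<le> K * ?H powr (- b)"
      using subspace_hyperplane_near[OF V'(1,2) _ homog_nonzero e V'(3)] d(1)
      unfolding K_def c_def[symmetric] by (auto simp: mult.assoc)
    have "V' \<noteq> {0}" using E(2) d(1) by auto
    then have H': "1 \<le> height V'" by (rule height_ge_1[OF E(1)])
    have "height V' \<le> K * (?H powr (- b) / ?e)" using E(3) e(1) by (simp add: field_simps)
    also have "?H powr (- b) / ?e = ?H powr a" using ab(3) by (simp flip: powr_diff) (simp add: algebra_simps)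
    finally have "?H powr (- b) \<le> K powr (b / a) * height V' powr (- b / a)"
      using H H' K ab by (intro powr_le_of_le_mult_powr) auto
    then have "K * ?H powr (- b) \<le> K * K powr (b / a) * height V' powr (- b / a)" using K by simp
    with E(4) have "proj_dist_subspace ?u V' * height V' \<le> K * K powr (b / a) * height V' powr (- b / a)"
      by linarith
    then have "proj_dist_subspace ?u V' \<le> K * K powr (b / a) * (height V' powr (- b / a) / height V')"
      using H' by (simp add: field_simps)
    also have "height V' powr (- b / a) / height V' = height V' powr (- 1 - b / a)"
      using H' by (simp add: powr_diff powr_minus_divide)
    finally have 1: "proj_dist_subspace ?u V' \<le> K * K powr (b / a) * height V' powr (- 1 - b / a)" .
    \<comment> \<open>Since the height is at least 1, distance times height bounds the
      distance.\<close>
    have "proj_dist_subspace ?u V' < \<eta>"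
    proof (rule ccontr)
      assume "\<not> proj_dist_subspace ?u V' < \<eta>"
      then have "\<eta> * 1 \<le> proj_dist_subspace ?u V' * height V'"
        using H' \<open>0 < \<eta>\<close> by (intro mult_mono) auto
      then show False using E(4) M(2)[OF V(2)] by simp
    qed
    with 1 E(1,2) show "\<exists>V. rational_subspace V \<and> dim V = d - 1 + 1 \<and>
      proj_dist_subspace ?u V \<le> K * K powr (b / a) * height V powr (- 1 - b / a) \<and>
      proj_dist_subspace ?u V < \<eta>" using d(1) by (intro exI[of _ V']) simp
  qed
  then show ?thesis by (simp add: ba)
qed

text \<open>Climbs from \<open>approx_exponent_0_nonneg\<close> by
  \<open>approx_exponent_up\<close>. Nonnegativity excludes the value minus infinity in the final
  comparison.\<close>

lemma approx_exponent_nonneg: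
  fixes \<Theta> :: "real ^ 'n::finite"
  assumes ind: "rat_independent (\<lambda>i. homog \<Theta> $ i)" and d: "d + 1 \<le> CARD('n)"
  shows "0 \<le> approx_exponent d \<Theta>"
  using d
proof (induction d)
  case 0
  show ?case by (rule approx_exponent_0_nonneg[OF ind])
next
  case (Suc d)
  define m where "m = real CARD('n) - real (Suc d) + 1"
  have m: "2 \<le> m" using Suc.prems by (simp add: m_def)
  \<comment> \<open>\<open>- (1 / m)\<close> is the zero of \<open>(m * w + 1) / (m - 1)\<close>;
    the slack below 0 is there because a supremum need not be attained.\<close>
  have "ereal (- (1 / m)) < 0" using m by simp
  also have "0 \<le> approx_exponent d \<Theta>" using Suc by simp
  finally obtain w where w: "infinite (approximants d \<Theta> w)" "- (1 / m) < w"
    unfolding approx_exponent_eq less_Sup_iff by auto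
  have "1 / m \<le> 1" using m by simp
  then have "- 1 < w" using w(2) by linarith
  then have "ereal (((real CARD('n) - real (Suc d) + 1) * w + 1) / (real CARD('n) - real (Suc d)))
      \<le> approx_exponent (Suc d) \<Theta>"
    using w(1) by (intro approx_exponent_up[OF ind _ Suc.prems]) simp_all
  then have "ereal ((m * w + 1) / (m - 1)) \<le> approx_exponent (Suc d) \<Theta>"
    unfolding m_def by (simp only: add_diff_cancel_right')
  moreover have "0 \<le> (m * w + 1) / (m - 1)"
    using m w(2) by (intro divide_nonneg_nonneg) (auto simp: field_simps)
  ultimately show ?case by (metis ereal_less_eq(5) order_trans)
qed

section \<open>Both inequalities in extended reals\<close>

theorem theorem2:
  fixes \<Theta> :: "real ^ 'n::finite" and d :: nat
  assumes "rat_independent (\<lambda>i. homog \<Theta> $ i)"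
    and "1 \<le> d" and "d \<le> CARD('n) - 1"
  shows "(if approx_exponent d \<Theta> = \<infinity> then ereal (real d)
            else ereal (real d) * approx_exponent d \<Theta> /
                   (approx_exponent d \<Theta> + ereal (real d) + 1))
           \<le> approx_exponent (d - 1) \<Theta>
       \<and> approx_exponent (d - 1) \<Theta>
           \<le> (if approx_exponent d \<Theta> = \<infinity> then \<infinity>
               else (ereal (real CARD('n) - real d) * approx_exponent d \<Theta> - 1) /
                      ereal (real CARD('n) - real d + 1))"
proof -
  let ?s = "approx_exponent d \<Theta>" and ?t = "approx_exponent (d - 1) \<Theta>"
  have d: "1 \<le> d" "d + 1 \<le> CARD('n)"
    using assms(2,3) by auto
  have s0: "0 \<le> ?s" and t0: "0 \<le> ?t"
    using approx_exponent_nonneg[OF assms(1)] d by auto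
  have "(if ?s = \<infinity> then ereal (real d) else ereal (real d) * ?s / (?s + ereal (real d) + 1)) \<le> ?t"
  proof (cases ?t)
    case (real \<tau>)
    then have \<tau>: "0 \<le> \<tau>" using t0 by simp
    show ?thesis
    \<comment> \<open>For \<open>\<tau> < real d\<close> the left-hand side can be inverted in
      \<open>?s\<close>; otherwise it suffices that it never exceeds \<open>real d\<close>.\<close>
    proof (cases "\<tau> < real d")
      case True
      \<comment> \<open>The bound solves \<open>real d * w / (w + real d + 1) = \<tau>\<close> for
        \<open>w\<close>; being finite, it also rules out \<open>?s = \<infinity>\<close>.\<close>
      have "?s \<le> ereal ((real d + 1) * \<tau> / (real d - \<tau>))"
      proof (rule approx_exponent_least)
        fix w assume w: "infinite (approximants d \<Theta> w)"
        show "ereal w \<le> ereal ((real d + 1) * \<tau> / (real d - \<tau>))"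
        proof (cases "0 < w")
          case pos: True
          have "real d * w / (w + real d + 1) \<le> \<tau>"
            using approx_exponent_down[OF assms(1) d w pos] real by simp
          then show ?thesis using pos True by (simp add: field_simps)
        next
          case False
          moreover have "0 \<le> (real d + 1) * \<tau> / (real d - \<tau>)" using \<tau> True by simp
          ultimately show ?thesis by simp
        qed
      qed
      then obtain \<sigma> where \<sigma>: "?s = ereal \<sigma>" "0 \<le> \<sigma>" "\<sigma> \<le> (real d + 1) * \<tau> / (real d - \<tau>)"
        using s0 by (cases ?s) auto
      then have "real d * \<sigma> / (\<sigma> + real d + 1) \<le> \<tau>" using True by (simp add: field_simps)
      then show ?thesis using \<sigma> real by (simp add: one_ereal_def)
    next
      case False
      show ?thesis
      proof (cases ?s)
        case s: (real \<sigma>)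
        then have \<sigma>: "0 \<le> \<sigma>" using s0 by simp
        then have "real d * \<sigma> / (\<sigma> + real d + 1) \<le> real d" by (simp add: field_simps)
        then have "real d * \<sigma> / (\<sigma> + real d + 1) \<le> \<tau>" using False by linarith
        then show ?thesis using s \<sigma> real by (simp add: one_ereal_def)
      qed (use False real s0 in auto)
    qed
  qed (use t0 in auto)
  moreover have "?t \<le> (if ?s = \<infinity> then \<infinity> else (ereal (real CARD('n) - real d) * ?s - 1) /
      ereal (real CARD('n) - real d + 1))"
  proof (cases ?s)
    case (real \<sigma>)
    then have \<sigma>: "0 \<le> \<sigma>" using s0 by simp
    define k where "k = real CARD('n) - real d"
    have k: "1 \<le> k" using d by (simp add: k_def)
    have "?t \<le> ereal ((k * \<sigma> - 1) / (k + 1))"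
    proof (rule approx_exponent_least)
      fix w assume w: "infinite (approximants (d - 1) \<Theta> w)"
      show "ereal w \<le> ereal ((k * \<sigma> - 1) / (k + 1))"
      proof (cases "- 1 < w")
        case True
        have "((k + 1) * w + 1) / k \<le> \<sigma>"
          using approx_exponent_up[OF assms(1) d w True] real by (simp add: k_def)
        then show ?thesis using k by (simp add: field_simps)
      next
        case False
        \<comment> \<open>For \<open>w \<le> - 1\<close> the lemma \<open>approx_exponent_up\<close>
          does not apply, but the claimed bound is already at least \<open>- 1\<close>.\<close>
        have "- 1 \<le> (k * \<sigma> - 1) / (k + 1)" using k mult_nonneg_nonneg[OF \<sigma>, of k] by (simp add: field_simps)
        with False show ?thesis by simp
      qed
    qed
    then show ?thesis using real k by (simp add: k_def one_ereal_def)
  qed (use s0 in auto)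
  ultimately show ?thesis by blast
qed

end
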